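(* Let $k$ be a field and $P$ a finite connected poset. Then the algebra $\Lambda_P$, together with the subspaces $$\Lambda_P^+=\operatorname{span}_k\{q_{R,U}^{\mathrm{op}}\mid R\in\mathrm{Int}(P),\ U\in\mathcal D(R)\},\qquad \Lambda_P^-=\operatorname{span}_k\{j_{U,S}^{\mathrm{op}}\mid S\in\mathrm{Int}(P),\ U\in\mathcal U(S)\},$$ and the degree function $\deg(S)=|S|$ for $S\in\mathrm{Int}(P)$, is a Reedy algebra; that is, $(\Lambda_P,\Lambda_P^+,\Lambda_P^-)$ is a Reedy algebra with respect to the complete set of primitive orthogonal idempotents $\{e_S\mid S\in\mathrm{Int}(P)\}$ and the degree function $\deg$.
   Context: A subset $S\subseteq P$ is connected if any $x,y\in S$ are joined by a sequence $x=x_0,\dots,x_r=y$ in $S$ with $x_{i-1},x_i$ comparable for all $i$; convex if $x,y\in S$ and $x\le z\le y$ imply $z\in S$; an interval if it is nonempty, connected and convex. $\mathrm{Int}(P)$ is the set of intervals of $P$. Representations of $P$ are functors from $P$ to finite-dimensional $k$-vector spaces, with morphism spaces $\mathrm{Hom}_P$. For $S\in\mathrm{Int}(P)$, $\mathbb I_S$ is the representation with $\mathbb I_S(x)=k$ for $x\in S$ and $0$ otherwise, and $\mathbb I_S(x\le y)=\mathrm{id}$ if $x,y\in S$ and $0$ otherwise. Put $G_P=\bigoplus_{S\in\mathrm{Int}(P)}\mathbb I_S$ and $\Lambda_P=\mathrm{End}_P(G_P)^{\mathrm{op}}$; $e_S\in\Lambda_P$ is the idempotent of the summand $\mathbb I_S$,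 so $e_R\Lambda_Pe_S=\mathrm{Hom}_P(\mathbb I_R,\mathbb I_S)$. A morphism $f$ viewed in $\Lambda_P$ is written $f^{\mathrm{op}}$, so $f^{\mathrm{op}}g^{\mathrm{op}}=(g\circ f)^{\mathrm{op}}$. This is an elementary finite-dimensional algebra. For $S\in\mathrm{Int}(P)$, a subset $C\subseteq S$ is a relative upset (resp. relative downset) in $S$ if $c\in C$, $x\in S$ and $c\le x$ (resp. $x\le c$) imply $x\in C$. $\mathcal U(S)$ (resp. $\mathcal D(S)$) is the set of intervals contained in $S$ that are relative upsets (resp. relative downsets) in $S$. For $U\in\mathcal D(R)$, $q_{R,U}\colon\mathbb I_R\to\mathbb I_U$ is the quotient map which is the identity at points of $U$ and zero elsewhere; for $U\in\mathcal U(S)$, $j_{U,S}\colon\mathbb I_U\to\mathbb I_S$ is the inclusion which is the identity at points of $U$ and zero elsewhere. Reedy algebra: let $\Lambda$ be an elementary finite-dimensional $k$-algebra ($\Lambda$ modulo its Jacobson radical is a finite product of copies of $k$) with a complete set of primitive orthogonal idempotents $\{e_\lambda\mid\lambda\in\mathcal L\}$, and $\Lambda^0=\bigoplus_\lambda k e_\lambda$. A Reedy structure consists of a function $\deg\colon\mathcal L\to\mathbb N$ and unital subalgebras $\Lambda^+,\Lambda^-\subseteq\Lambda$ containing $\Lambda^0$ such that: (R1) $e_\lambda\Lambda^+e_\lambda=ke_\lambda$ for all $\lambda$, and for $\lambda\ne\mu$, $e_\mu\Lambda^+e_\lambda\neq0$ implies $\deg(\mu)>\deg(\lambda)$; (R2)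 $e_\lambda\Lambda^-e_\lambda=ke_\lambda$ for all $\lambda$, and for $\lambda\neq\mu$, $e_\mu\Lambda^-e_\lambda\ne0$ implies $\deg(\mu)<\deg(\lambda)$; (R3) multiplication induces an isomorphism of $k$-vector spaces $\Lambda^+\otimes_{\Lambda^0}\Lambda^-\to\Lambda$. Then $(\Lambda,\Lambda^+,\Lambda^-)$ is called a Reedy algebra. *)

theory Defs
  imports
    HOL.Vector_Spaces
    "HOL-Library.Function_Algebras"
    "HOL-Library.Set_Algebras"
    "HOL-Library.Poly_Mapping"
begin

section \<open>Algebras over a field\<close>

locale k_algebra = vector_space scale
  for scale :: "'k::field \<Rightarrow> 'a::ring_1 \<Rightarrow> 'a" (infixr "*s" 75) +
  assumes mult_scale_left: "(c *s x) * y = c *s (x * y)"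
    and mult_scale_right: "x * (c *s y) = c *s (x * y)"
begin

definition unital_subalgebra :: "'a set \<Rightarrow> bool" where
  "unital_subalgebra A \<longleftrightarrow> subspace A \<and> 1 \<in> A \<and> (\<forall>x\<in>A. \<forall>y\<in>A. x * y \<in> A)"

end

definition left_ideal :: "'a::ring_1 set \<Rightarrow> bool" where
  "left_ideal I \<longleftrightarrow> 0 \<in> I \<and> (\<forall>x\<in>I. \<forall>y\<in>I. x + y \<in> I) \<and> (\<forall>a. \<forall>x\<in>I. a * x \<in> I)"

definition maximal_left_ideal :: "'a::ring_1 set \<Rightarrow> bool" where
  "maximal_left_ideal I \<longleftrightarrow>
     left_ideal I \<and> I \<noteq> UNIV \<and> (\<forall>J. left_ideal J \<longrightarrow> I \<subseteq> J \<longrightarrow> J = I \<or> J = UNIV)"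

definition jacobson_radical :: "'a::ring_1 set" where
  "jacobson_radical = \<Inter>{I. maximal_left_ideal I}"

definition primitive_idempotent :: "'a::ring_1 \<Rightarrow> bool" where
  "primitive_idempotent e \<longleftrightarrow> e * e = e \<and> e \<noteq> 0 \<and>
     (\<forall>f g. f * f = f \<longrightarrow> g * g = g \<longrightarrow> f * g = 0 \<longrightarrow> g * f = 0 \<longrightarrow> e = f + g \<longrightarrow> f = 0 \<or> g = 0)"

definition complete_primitive_orthogonal_idempotents :: "'i set \<Rightarrow> ('i \<Rightarrow> 'a::ring_1) \<Rightarrow> bool" where
  "complete_primitive_orthogonal_idempotents L e \<longleftrightarrow>
     finite L \<and> (\<forall>l\<in>L. primitive_idempotent (e l)) \<and>
     (\<forall>l\<in>L. \<forall>m\<in>L. l \<noteq> m \<longrightarrow> e l * e m = 0) \<and> (\<Sum>l\<in>L. e l) = 1"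

text \<open>The quotient by the radical \<open>J\<close> is the set of cosets \<open>x +o J\<close>, with operations computed on
  representatives. The product of \<open>n\<close> copies of \<open>k\<close> is the set of functions \<open>nat \<Rightarrow> 'k\<close>
  vanishing outside \<open>{..<n}\<close>, with componentwise operations.\<close>

locale elementary_algebra = k_algebra scale
  for scale :: "'k::field \<Rightarrow> 'a::ring_1 \<Rightarrow> 'a" (infixr "*s" 75) +
  assumes finite_dimensional: "\<exists>B. finite B \<and> span B = UNIV"
    and elementary:
      "\<exists>n. \<exists>h :: 'a set \<Rightarrow> nat \<Rightarrow> 'k.
         bij_betw h (range (\<lambda>x. x +o jacobson_radical)) {v. \<forall>i\<ge>n. v i = 0} \<and>
         (\<forall>i<n. h (1 +o jacobson_radical) i = 1) \<and>
         (\<forall>x y i. h ((x + y) +o jacobson_radical) i =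
            h (x +o jacobson_radical) i + h (y +o jacobson_radical) i) \<and>
         (\<forall>x y i. h ((x * y) +o jacobson_radical) i =
            h (x +o jacobson_radical) i * h (y +o jacobson_radical) i) \<and>
         (\<forall>c x i. h ((c *s x) +o jacobson_radical) i = c * h (x +o jacobson_radical) i)"


section \<open>Tensor products over a subalgebra\<close>

text \<open>For subspaces \<open>M\<close>, \<open>N\<close> of an algebra and a subalgebra \<open>A\<close> acting on \<open>M\<close> from the right and on
  \<open>N\<close> from the left by multiplication, the tensor product \<open>M \<otimes>\<^sub>A N\<close> is the quotient of the free vector
  space on \<open>M \<times> N\<close> by the usual relations; its elements are the cosets of the relation subspace, with
  linear structure computed on representatives.\<close>

definition free_scale :: "'k::field \<Rightarrow> ('b \<Rightarrow>\<^sub>0 'k) \<Rightarrow> ('b \<Rightarrow>\<^sub>0 'k)" where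
  "free_scale c = Poly_Mapping.map ((*) c)"

lemma lookup_free_scale [simp]:
  "Poly_Mapping.lookup (free_scale c f) b = c * Poly_Mapping.lookup f b"
  by (simp add: free_scale_def Poly_Mapping.map.rep_eq when_def)

lemma vector_space_free_scale: "vector_space free_scale"
  by unfold_locales
    (auto intro!: poly_mapping_eqI simp: lookup_add algebra_simps)

definition free_space :: "'b set \<Rightarrow> ('b \<Rightarrow>\<^sub>0 'k::field) set" where
  "free_space X = {f. Poly_Mapping.keys f \<subseteq> X}"

abbreviation free_gen :: "'a \<Rightarrow> 'a \<Rightarrow> ('a \<times> 'a \<Rightarrow>\<^sub>0 'k::field)" where
  "free_gen m n \<equiv> Poly_Mapping.single (m, n) 1"

context k_algebra
begin

definition tensor_relations :: "'a set \<Rightarrow> 'a set \<Rightarrow> 'a set \<Rightarrow> ('a \<times> 'a \<Rightarrow>\<^sub>0 'k) set" where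
  "tensor_relations A M N = module.span free_scale
     ({free_gen (m + m') n - free_gen m n - free_gen m' n | m m' n. m \<in> M \<and> m' \<in> M \<and> n \<in> N} \<union>
      {free_gen m (n + n') - free_gen m n - free_gen m n' | m n n'. m \<in> M \<and> n \<in> N \<and> n' \<in> N} \<union>
      {free_gen (c *s m) n - free_scale c (free_gen m n) | c m n. m \<in> M \<and> n \<in> N} \<union>
      {free_gen m (c *s n) - free_scale c (free_gen m n) | c m n. m \<in> M \<and> n \<in> N} \<union>
      {free_gen (m * a) n - free_gen m (a * n) | m a n. m \<in> M \<and> a \<in> A \<and> n \<in> N})"

definition tensor_product :: "'a set \<Rightarrow> 'a set \<Rightarrow> 'a set \<Rightarrow> ('a \<times> 'a \<Rightarrow>\<^sub>0 'k) set set" where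
  "tensor_product A M N = (\<lambda>f. f +o tensor_relations A M N) ` free_space (M \<times> N)"

definition free_mult :: "('a \<times> 'a \<Rightarrow>\<^sub>0 'k) \<Rightarrow> 'a" where
  "free_mult f = (\<Sum>(m, n)\<in>Poly_Mapping.keys f. Poly_Mapping.lookup f (m, n) *s (m * n))"

text \<open>The linear map \<open>free_mult\<close>, \<open>m \<otimes> n \<mapsto> m * n\<close>, descends to a map \<open>h\<close> on \<open>M \<otimes>\<^sub>A N\<close>, which is
  bijective onto the whole algebra. Linearity of \<open>h\<close> is that of \<open>free_mult\<close>.\<close>

definition mult_induces_iso :: "'a set \<Rightarrow> 'a set \<Rightarrow> 'a set \<Rightarrow> bool" where
  "mult_induces_iso A M N \<longleftrightarrow>
     (\<exists>h. (\<forall>f\<in>free_space (M \<times> N). h (f +o tensor_relations A M N) = free_mult f) \<and>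
          bij_betw h (tensor_product A M N) UNIV)"

end


section \<open>Reedy algebras\<close>

locale reedy_algebra = elementary_algebra scale
  for scale :: "'k::field \<Rightarrow> 'a::ring_1 \<Rightarrow> 'a" (infixr "*s" 75) +
  fixes L :: "'i set" and e :: "'i \<Rightarrow> 'a" and deg :: "'i \<Rightarrow> nat"
    and Lplus Lminus :: "'a set"
  assumes idempotents: "complete_primitive_orthogonal_idempotents L e"
    and subalgebra_plus: "unital_subalgebra Lplus" "span (e ` L) \<subseteq> Lplus"
    and subalgebra_minus: "unital_subalgebra Lminus" "span (e ` L) \<subseteq> Lminus"
    and R1_diag: "\<And>l. l \<in> L \<Longrightarrow> {e l * x * e l | x. x \<in> Lplus} = {c *s e l | c. True}"
    and R1_deg: "\<And>l m. l \<in> L \<Longrightarrow> m \<in> L \<Longrightarrow> l \<noteq> m \<Longrightarrow>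
      {e m * x * e l | x. x \<in> Lplus} \<noteq> {0} \<Longrightarrow> deg m > deg l"
    and R2_diag: "\<And>l. l \<in> L \<Longrightarrow> {e l * x * e l | x. x \<in> Lminus} = {c *s e l | c. True}"
    and R2_deg: "\<And>l m. l \<in> L \<Longrightarrow> m \<in> L \<Longrightarrow> l \<noteq> m \<Longrightarrow>
      {e m * x * e l | x. x \<in> Lminus} \<noteq> {0} \<Longrightarrow> deg m < deg l"
    and R3: "mult_induces_iso (span (e ` L)) Lplus Lminus"


section \<open>Intervals of a poset\<close>

definition poset_connected :: "'p::order set \<Rightarrow> bool" where
  "poset_connected S \<longleftrightarrow>
     (\<forall>x\<in>S. \<forall>y\<in>S. (x, y) \<in> {(a, b). a \<in> S \<and> b \<in> S \<and> (a \<le> b \<or> b \<le> a)}\<^sup>*)"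

definition poset_convex :: "'p::order set \<Rightarrow> bool" where
  "poset_convex S \<longleftrightarrow> (\<forall>x\<in>S. \<forall>y\<in>S. \<forall>z. x \<le> z \<longrightarrow> z \<le> y \<longrightarrow> z \<in> S)"

definition intervals :: "'p::order set set" where
  "intervals = {S. S \<noteq> {} \<and> poset_connected S \<and> poset_convex S}"

definition relative_upset :: "'p::order set \<Rightarrow> 'p set \<Rightarrow> bool" where
  "relative_upset C S \<longleftrightarrow> C \<subseteq> S \<and> (\<forall>c\<in>C. \<forall>x\<in>S. c \<le> x \<longrightarrow> x \<in> C)"

definition relative_downset :: "'p::order set \<Rightarrow> 'p set \<Rightarrow> bool" where
  "relative_downset C S \<longleftrightarrow> C \<subseteq> S \<and> (\<forall>c\<in>C. \<forall>x\<in>S. x \<le> c \<longrightarrow> x \<in> C)"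

definition upset_intervals :: "'p::order set \<Rightarrow> 'p set set" where
  "upset_intervals S = {U \<in> intervals. relative_upset U S}"

definition downset_intervals :: "'p::order set \<Rightarrow> 'p set set" where
  "downset_intervals S = {U \<in> intervals. relative_downset U S}"


section \<open>Representations of a poset\<close>

text \<open>The vector spaces of a representation are subspaces of one ambient vector space. A linear map
  between such subspaces is encoded as a function on the ambient types that is \<open>0\<close> outside its domain,
  so that morphisms are determined by their values on the domain and are added pointwise.\<close>

record ('k, 'p, 'v) rep =
  scl :: "'k \<Rightarrow> 'v \<Rightarrow> 'v"
  spc :: "'p \<Rightarrow> 'v set"
  tr :: "'p \<Rightarrow> 'p \<Rightarrow> 'v \<Rightarrow> 'v"

definition linear_between ::
  "('k::field \<Rightarrow> 'v::ab_group_add \<Rightarrow> 'v) \<Rightarrow> 'v set \<Rightarrow>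
   ('k \<Rightarrow> 'w::ab_group_add \<Rightarrow> 'w) \<Rightarrow> 'w set \<Rightarrow> ('v \<Rightarrow> 'w) \<Rightarrow> bool" where
  "linear_between s A t B f \<longleftrightarrow>
     (\<forall>v\<in>A. f v \<in> B) \<and> (\<forall>v\<in>A. \<forall>w\<in>A. f (v + w) = f v + f w) \<and>
     (\<forall>c. \<forall>v\<in>A. f (s c v) = t c (f v)) \<and> (\<forall>v. v \<notin> A \<longrightarrow> f v = 0)"

locale poset_rep =
  fixes V :: "('k::field, 'p::order, 'v::ab_group_add) rep"
  assumes vs: "vector_space (scl V)"
    and sub: "\<And>x. module.subspace (scl V) (spc V x)"
    and fin_dim: "\<And>x. \<exists>B. finite B \<and> module.span (scl V) B = spc V x"
    and tr_linear: "\<And>x y. x \<le> y \<Longrightarrow> linear_between (scl V) (spc V x) (scl V) (spc V y) (tr V x y)"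
    and tr_id: "\<And>x v. v \<in> spc V x \<Longrightarrow> tr V x x v = v"
    and tr_comp: "\<And>x y z v. x \<le> y \<Longrightarrow> y \<le> z \<Longrightarrow> v \<in> spc V x \<Longrightarrow>
      tr V y z (tr V x y v) = tr V x z v"

definition Hom_P ::
  "('k::field, 'p::order, 'v::ab_group_add) rep \<Rightarrow> ('k, 'p, 'w::ab_group_add) rep \<Rightarrow>
   ('p \<Rightarrow> 'v \<Rightarrow> 'w) set" where
  "Hom_P V W = {f. (\<forall>x. linear_between (scl V) (spc V x) (scl W) (spc W x) (f x)) \<and>
     (\<forall>x y. x \<le> y \<longrightarrow> (\<forall>v\<in>spc V x. f y (tr V x y v) = tr W x y (f x v)))}"

definition comp_P :: "('p \<Rightarrow> 'v \<Rightarrow> 'w) \<Rightarrow> ('p \<Rightarrow> 'u \<Rightarrow> 'v) \<Rightarrow> 'p \<Rightarrow> 'u \<Rightarrow> 'w" where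
  "comp_P g f = (\<lambda>x v. g x (f x v))"

definition id_P :: "('k, 'p, 'v::zero) rep \<Rightarrow> 'p \<Rightarrow> 'v \<Rightarrow> 'v" where
  "id_P V = (\<lambda>x v. if v \<in> spc V x then v else 0)"

definition direct_sum ::
  "'i set \<Rightarrow> ('i \<Rightarrow> ('k, 'p, 'v::zero) rep) \<Rightarrow> ('k, 'p, 'i \<Rightarrow> 'v) rep" where
  "direct_sum I V =
     (let D = (\<lambda>x. {v. (\<forall>i\<in>I. v i \<in> spc (V i) x) \<and> (\<forall>i. i \<notin> I \<longrightarrow> v i = 0)}) in
      \<lparr> scl = (\<lambda>c v i. scl (V i) c (v i)),
        spc = D,
        tr = (\<lambda>x y v i. if v \<in> D x \<and> i \<in> I then tr (V i) x y (v i) else 0) \<rparr>)"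

definition direct_sum_inj ::
  "('i \<Rightarrow> ('k, 'p, 'v::zero) rep) \<Rightarrow> 'i \<Rightarrow> 'p \<Rightarrow> 'v \<Rightarrow> 'i \<Rightarrow> 'v" where
  "direct_sum_inj V i = (\<lambda>x v j. if v \<in> spc (V i) x \<and> j = i then v else 0)"

definition direct_sum_proj ::
  "'i set \<Rightarrow> ('i \<Rightarrow> ('k, 'p, 'v::zero) rep) \<Rightarrow> 'i \<Rightarrow> 'p \<Rightarrow> ('i \<Rightarrow> 'v) \<Rightarrow> 'v" where
  "direct_sum_proj I V i = (\<lambda>x v. if v \<in> spc (direct_sum I V) x then v i else 0)"


section \<open>Interval representations\<close>

definition interval_rep :: "'p::order set \<Rightarrow> ('k::field, 'p, 'k) rep" where
  "interval_rep S =
     \<lparr> scl = (*),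
       spc = (\<lambda>x. if x \<in> S then UNIV else {0}),
       tr = (\<lambda>x y v. if x \<in> S \<and> y \<in> S then v else 0) \<rparr>"

text \<open>The projection \<open>quot_map R U\<close> from the interval representation of \<open>R\<close> to that of \<open>U\<close>, and the
  inclusion \<open>incl_map U S\<close> of the one of \<open>U\<close> into that of \<open>S\<close>. Source and target do not enter
  the formulas, since all these representations live in the ambient space \<open>'k\<close>.\<close>

definition quot_map :: "'p set \<Rightarrow> 'p set \<Rightarrow> 'p \<Rightarrow> 'k::field \<Rightarrow> 'k" where
  "quot_map R U = (\<lambda>x v. if x \<in> U then v else 0)"

definition incl_map :: "'p set \<Rightarrow> 'p set \<Rightarrow> 'p \<Rightarrow> 'k::field \<Rightarrow> 'k" where
  "incl_map U S = (\<lambda>x v. if x \<in> U then v else 0)"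

definition G_P :: "('k::field, 'p::order, 'p set \<Rightarrow> 'k) rep" where
  "G_P = direct_sum intervals interval_rep"

lemma linear_between_0:
  assumes "linear_between s A t B f"
  shows "f 0 = 0"
proof (cases "0 \<in> A")
  case True
  then have "f (0 + 0) = f 0 + f 0"
    using assms unfolding linear_between_def by blast
  then show ?thesis by simp
qed (use assms in \<open>auto simp: linear_between_def\<close>)

lemma linear_between_comp:
  assumes f: "linear_between s A t B f" and g: "linear_between t B u C g"
  shows "linear_between s A u C (\<lambda>v. g (f v))"
  using f g linear_between_0[OF g] unfolding linear_between_def by simp

lemma Hom_P_comp:
  assumes f: "f \<in> Hom_P U V" and g: "g \<in> Hom_P V W"
  shows "comp_P g f \<in> Hom_P U W"
proof -
  have "f x v \<in> spc V x" if "v \<in> spc U x" for x v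
    using f that by (auto simp: Hom_P_def linear_between_def)
  then show ?thesis
    using assms linear_between_comp unfolding Hom_P_def comp_P_def by fastforce
qed

lemma Hom_P_id:
  assumes "poset_rep V"
  shows "id_P V \<in> Hom_P V V"
proof -
  interpret poset_rep V by fact
  interpret vector_space "scl V" by (fact vs)
  have "tr V x y v \<in> spc V y" if "x \<le> y" "v \<in> spc V x" for x y v
    using tr_linear[OF that(1)] that(2) by (auto simp: linear_between_def)
  then show ?thesis
    using subspace_add[OF sub] subspace_scale[OF sub]
    by (auto simp: Hom_P_def id_P_def linear_between_def)
qed

lemma comp_P_id:
  assumes "f \<in> Hom_P V W"
  shows "comp_P (id_P W) f = f" "comp_P f (id_P V) = f"
proof -
  have f0: "f x 0 = 0" and out: "v \<notin> spc V x \<Longrightarrow> f x v = 0"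
    and into: "v \<in> spc V x \<Longrightarrow> f x v \<in> spc W x" for x v
    using assms linear_between_0[of "scl V" "spc V x" "scl W" "spc W x" "f x"]
    by (auto simp: Hom_P_def linear_between_def)
  show "comp_P (id_P W) f = f"
  proof (intro ext)
    fix x v show "comp_P (id_P W) f x v = f x v"
      using into[of v x] out[of v x] by (auto simp: comp_P_def id_P_def)
  qed
  show "comp_P f (id_P V) = f"
  proof (intro ext)
    fix x v show "comp_P f (id_P V) x v = f x v"
      using f0[of x] out[of v x] by (auto simp: comp_P_def id_P_def)
  qed
qed

lemma poset_rep_interval_rep:
  assumes "S \<in> intervals"
  shows "poset_rep (interval_rep S :: ('k::field, 'p::order, 'k) rep)"
proof -
  interpret k: vector_space "(*) :: 'k \<Rightarrow> 'k \<Rightarrow> 'k"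
    by unfold_locales (auto simp: algebra_simps)
  have "k.span {1} = (UNIV :: 'k set)"
    by (auto simp: k.span_singleton)
  then have fd: "\<exists>B. finite B \<and> k.span B = (if x \<in> S then UNIV else {0})" for x
    by (intro exI[of _ "if x \<in> S then {1} else {}"]) simp
  have convex: "y \<in> S" if "x \<in> S" "z \<in> S" "x \<le> y" "y \<le> z" for x y z
    using assms that unfolding intervals_def poset_convex_def by blast
  have eqs: "scl (interval_rep S) = ((*) :: 'k \<Rightarrow> _)"
    "spc (interval_rep S :: ('k, 'p, 'k) rep) = (\<lambda>x. if x \<in> S then UNIV else {0})"
    "tr (interval_rep S :: ('k, 'p, 'k) rep) = (\<lambda>x y v. if x \<in> S \<and> y \<in> S then v else 0)"
    by (simp_all add: interval_rep_def)
  show ?thesis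
    unfolding poset_rep_def eqs
  proof (intro conjI allI impI)
    show "(if y \<in> S \<and> z \<in> S then if x \<in> S \<and> y \<in> S then v else 0 else 0) =
        (if x \<in> S \<and> z \<in> S then v else 0)" if "x \<le> y" "y \<le> z" for x y z and v :: 'k
      using convex[OF _ _ that] by auto
    show "(if x \<in> S \<and> x \<in> S then v else 0) = v" if "v \<in> (if x \<in> S then UNIV else {0})"
      for x and v :: 'k
      using that by (simp split: if_splits)
  qed (use fd in \<open>simp_all add: k.vector_space_axioms k.subspace_def linear_between_def\<close>)
qed

lemma poset_rep_direct_sum:
  assumes fin: "finite I" and V: "\<And>i. i \<in> I \<Longrightarrow> poset_rep (V i)"
    and vsV: "\<And>i. vector_space (scl (V i))"
  shows "poset_rep (direct_sum I V :: ('k::field, 'p::order, 'i \<Rightarrow> 'v::ab_group_add) rep)"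
proof -
  let ?s = "\<lambda>(c::'k) (v :: 'i \<Rightarrow> 'v) i. scl (V i) c (v i)"
  let ?D = "\<lambda>x. {v. (\<forall>i\<in>I. v i \<in> spc (V i) x) \<and> (\<forall>i. i \<notin> I \<longrightarrow> v i = 0)}"
  note subV = poset_rep.sub[OF V]
  interpret vector_space ?s
    by unfold_locales
      (simp_all add: fun_eq_iff vector_space.vector_space_assms[OF vsV])
  have scale0: "scl (V i) c 0 = 0" for i c
    using vsV[of i] by (metis add_cancel_right_right vector_space.vector_space_assms(1))
  have sp: "0 \<in> spc (V i) x" "v \<in> spc (V i) x \<Longrightarrow> w \<in> spc (V i) x \<Longrightarrow> v + w \<in> spc (V i) x"
    "v \<in> spc (V i) x \<Longrightarrow> scl (V i) c v \<in> spc (V i) x" if "i \<in> I" for i x v w c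
  proof -
    interpret i: vector_space "scl (V i)" by (rule vsV)
    show "0 \<in> spc (V i) x" "v \<in> spc (V i) x \<Longrightarrow> w \<in> spc (V i) x \<Longrightarrow> v + w \<in> spc (V i) x"
    "v \<in> spc (V i) x \<Longrightarrow> scl (V i) c v \<in> spc (V i) x"
      using subV[OF that, of x] by (auto simp: i.subspace_def)
  qed
  have sub: "subspace (?D x)" for x
    by (auto simp: subspace_def sp scale0)
  have fd: "\<exists>B. finite B \<and> span B = ?D x" for x
  proof -
    have "\<forall>i\<in>I. \<exists>B. finite B \<and> module.span (scl (V i)) B = spc (V i) x"
      using poset_rep.fin_dim[OF V] by blast
    from bchoice[OF this] obtain B where
      B: "\<And>i. i \<in> I \<Longrightarrow> finite (B i)" "\<And>i. i \<in> I \<Longrightarrow> module.span (scl (V i)) (B i) = spc (V i) x"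
      by blast
    let ?inj = "\<lambda>i v j. if j = i then v else (0::'v)"
    let ?B = "\<Union>i\<in>I. ?inj i ` B i"
    have inj: "?inj i v \<in> span ?B" if i: "i \<in> I" and v: "v \<in> spc (V i) x" for i v
    proof -
      interpret i: vector_space "scl (V i)" by (rule vsV)
      have "v \<in> i.span (B i)" using v B(2)[OF i] by simp
      then show ?thesis
      proof (induction rule: i.span_induct_alt)
        case base
        have "?inj i 0 = 0" by auto
        then show ?case by (simp only: span_zero)
      next
        case (step c b y)
        have "?inj i b \<in> span ?B"
          by (rule span_base) (use step i in blast)
        then have "?s c (?inj i b) + ?inj i y \<in> span ?B"
          by (intro span_add span_scale step.IH)
        moreover have "?s c (?inj i b) + ?inj i y = ?inj i (scl (V i) c b + y)"
          by (auto simp: fun_eq_iff scale0)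
        ultimately show ?case by (simp only:)
      qed
    qed
    have "?D x \<subseteq> span ?B"
    proof
      fix v assume v: "v \<in> ?D x"
      have "(\<Sum>i\<in>I. ?inj i (v i)) j = v j" for j
      proof -
        have "(\<Sum>i\<in>F. ?inj i (v i)) j = (\<Sum>i\<in>F. ?inj i (v i) j)" for F
          by (induction F rule: infinite_finite_induct) auto
        then show ?thesis using v fin by (auto simp: sum.delta')
      qed
      then have "v = (\<Sum>i\<in>I. ?inj i (v i))" by auto
      moreover have "(\<Sum>i\<in>I. ?inj i (v i)) \<in> span ?B"
        using v inj by (intro span_sum) auto
      ultimately show "v \<in> span ?B" by (simp only:)
    qed
    moreover have "span ?B \<subseteq> ?D x"
    proof (rule span_minimal[OF _ sub])
      have "B i \<subseteq> spc (V i) x" if "i \<in> I" for i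
      proof -
        interpret i: vector_space "scl (V i)" by (rule vsV)
        show ?thesis using B(2)[OF that] i.span_superset by blast
      qed
      then show "?B \<subseteq> ?D x" using sp(1) by (auto simp: subset_iff)
    qed
    moreover have "finite ?B" using fin B(1) by auto
    ultimately show ?thesis by blast
  qed
  have lin: "linear_between (scl (V i)) (spc (V i) x) (scl (V i)) (spc (V i) y) (tr (V i) x y)"
    if "i \<in> I" "x \<le> y" for i x y by (rule poset_rep.tr_linear[OF V[OF that(1)] that(2)])
  have tr_in: "tr (V i) x y v \<in> spc (V i) y"
    and tr_add: "w \<in> spc (V i) x \<Longrightarrow> tr (V i) x y (v + w) = tr (V i) x y v + tr (V i) x y w"
    and tr_scale: "tr (V i) x y (scl (V i) c v) = scl (V i) c (tr (V i) x y v)"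
    if "i \<in> I" "x \<le> y" "v \<in> spc (V i) x" for i x y v w c
    using lin[OF that(1,2)] that(3) by (auto simp: linear_between_def)
  have tr_id: "tr (V i) x x v = v" if "i \<in> I" "v \<in> spc (V i) x" for i x v
    by (rule poset_rep.tr_id[OF V[OF that(1)] that(2)])
  have tr_comp: "tr (V i) y z (tr (V i) x y v) = tr (V i) x z v"
    if "i \<in> I" "x \<le> y" "y \<le> z" "v \<in> spc (V i) x" for i x y z v
    by (rule poset_rep.tr_comp[OF V[OF that(1)] that(2,3,4)])
  have eqs: "scl (direct_sum I V) = ?s" "spc (direct_sum I V) = ?D"
    "tr (direct_sum I V) = (\<lambda>x y v i. if v \<in> ?D x \<and> i \<in> I then tr (V i) x y (v i) else 0)"
    by (simp_all add: direct_sum_def Let_def)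
  show ?thesis
    unfolding poset_rep_def eqs
  proof (intro conjI allI impI)
    show "linear_between ?s (?D x) ?s (?D y)
        (\<lambda>v i. if v \<in> ?D x \<and> i \<in> I then tr (V i) x y (v i) else 0)" if "x \<le> y" for x y
      using that
      by (auto simp: linear_between_def fun_eq_iff tr_in tr_add tr_scale sp scale0)
  qed (auto simp: vector_space_axioms sub fd fun_eq_iff tr_id tr_in tr_comp)
qed

lemma poset_rep_G_P: "poset_rep (G_P :: ('k::field, 'p::{finite,order}, 'p set \<Rightarrow> 'k) rep)"
  unfolding G_P_def
proof (rule poset_rep_direct_sum)
  show "vector_space (scl (interval_rep S :: ('k, 'p, 'k) rep))" for S
    by unfold_locales (auto simp: interval_rep_def algebra_simps)
qed (auto intro: poset_rep_interval_rep)

lemma Hom_P_subspace: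
  assumes "poset_rep V" "poset_rep W"
  shows "0 \<in> Hom_P V W"
    and "f \<in> Hom_P V W \<Longrightarrow> g \<in> Hom_P V W \<Longrightarrow> f + g \<in> Hom_P V W"
    and "f \<in> Hom_P V W \<Longrightarrow> (\<lambda>x v. scl W c (f x v)) \<in> Hom_P V W"
    and "f \<in> Hom_P V W \<Longrightarrow> - f \<in> Hom_P V W"
    and "f \<in> Hom_P V W \<Longrightarrow> g \<in> Hom_P V W \<Longrightarrow> f - g \<in> Hom_P V W"
proof -
  interpret V: poset_rep V by fact
  interpret W: poset_rep W by fact
  interpret W: vector_space "scl W" by (fact W.vs)
  note sub = W.subspace_0[OF W.sub] W.subspace_add[OF W.sub] W.subspace_scale[OF W.sub]
  have tr: "tr W x y 0 = 0" "w \<in> spc W x \<Longrightarrow> tr W x y (scl W c w) = scl W c (tr W x y w)"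
    "w \<in> spc W x \<Longrightarrow> w' \<in> spc W x \<Longrightarrow> tr W x y (w + w') = tr W x y w + tr W x y w'"
    if "x \<le> y" for x y w w' c
    using W.tr_linear[OF that] linear_between_0[OF W.tr_linear[OF that]]
    by (auto simp: linear_between_def)
  have trV: "tr V x y v \<in> spc V y" if "x \<le> y" "v \<in> spc V x" for x y v
    using V.tr_linear[OF that(1)] that(2) by (auto simp: linear_between_def)
  show 0: "0 \<in> Hom_P V W"
    by (auto simp: Hom_P_def linear_between_def sub tr)
  show add: "f + g \<in> Hom_P V W" if "f \<in> Hom_P V W" "g \<in> Hom_P V W" for f g
    using that by (auto simp: Hom_P_def linear_between_def sub tr W.scale_right_distrib)
  show scale: "(\<lambda>x v. scl W c (f x v)) \<in> Hom_P V W" if "f \<in> Hom_P V W" for c f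
    using that
    by (auto simp: Hom_P_def linear_between_def sub tr W.scale_right_distrib W.scale_left_commute)
  have minus: "- f = (\<lambda>x v. scl W (- 1) (f x v))" for f :: "'b \<Rightarrow> 'c \<Rightarrow> 'd"
    by (auto simp: fun_eq_iff)
  show uminus: "- f \<in> Hom_P V W" if "f \<in> Hom_P V W" for f
    using scale[OF that, of "- 1"] by (simp only: minus)
  show "f - g \<in> Hom_P V W" if "f \<in> Hom_P V W" "g \<in> Hom_P V W" for f g
    using add[OF that(1) uminus[OF that(2)]] by simp
qed


section \<open>The algebra \<open>\<Lambda>\<^sub>P\<close>\<close>

text \<open>The poset is the type \<open>'p\<close>.\<close>

typedef (overloaded) ('k::field, 'p::"{finite,order}") Lambda_P =
  "Hom_P G_P G_P :: ('p \<Rightarrow> ('p set \<Rightarrow> 'k) \<Rightarrow> 'p set \<Rightarrow> 'k) set"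
  using Hom_P_id[OF poset_rep_G_P] by blast

setup_lifting type_definition_Lambda_P

lemmas Hom_G_P_subspace = Hom_P_subspace[OF poset_rep_G_P poset_rep_G_P]

lemma scl_G_P [simp]: "scl (G_P :: ('k::field, 'p::order, 'p set \<Rightarrow> 'k) rep) c v S = c * v S"
  by (simp add: G_P_def direct_sum_def Let_def interval_rep_def)

lemma Hom_G_P_scale:
  fixes f :: "'p::{finite,order} \<Rightarrow> ('p set \<Rightarrow> 'k::field) \<Rightarrow> 'p set \<Rightarrow> 'k"
  assumes "f \<in> Hom_P G_P G_P"
  shows "(\<lambda>x v S. c * f x v S) \<in> Hom_P G_P G_P"
proof -
  have "scl (G_P :: ('k, 'p, 'p set \<Rightarrow> 'k) rep) = (\<lambda>c v S. c * v S)"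
    by (simp add: fun_eq_iff)
  then show ?thesis using Hom_G_P_subspace(3)[OF assms, of c] by simp
qed

instantiation Lambda_P :: (field, "{finite,order}") ring_1
begin

lift_definition zero_Lambda_P :: "('a, 'b) Lambda_P" is 0
  by (rule Hom_G_P_subspace)

lift_definition plus_Lambda_P :: "('a, 'b) Lambda_P \<Rightarrow> ('a, 'b) Lambda_P \<Rightarrow> ('a, 'b) Lambda_P" is "(+)"
  by (rule Hom_G_P_subspace)

lift_definition uminus_Lambda_P :: "('a, 'b) Lambda_P \<Rightarrow> ('a, 'b) Lambda_P" is uminus
  by (rule Hom_G_P_subspace)

lift_definition minus_Lambda_P :: "('a, 'b) Lambda_P \<Rightarrow> ('a, 'b) Lambda_P \<Rightarrow> ('a, 'b) Lambda_P" is "(-)"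
  by (rule Hom_G_P_subspace)

lift_definition one_Lambda_P :: "('a, 'b) Lambda_P" is "id_P G_P"
  by (rule Hom_P_id[OF poset_rep_G_P])

text \<open>The multiplication is that of the opposite of the endomorphism algebra.\<close>

lift_definition times_Lambda_P :: "('a, 'b) Lambda_P \<Rightarrow> ('a, 'b) Lambda_P \<Rightarrow> ('a, 'b) Lambda_P"
  is "\<lambda>f g. comp_P g f"
  by (rule Hom_P_comp)

instance
proof
  fix a b c :: "('a, 'b) Lambda_P"
  show "a + b + c = a + (b + c)" by transfer (simp add: add.assoc)
  show "a + b = b + a" by transfer (simp add: add.commute)
  show "0 + a = a" by transfer simp
  show "- a + a = 0" by transfer simp
  show "a - b = a + - b" by transfer simp
  show "a * b * c = a * (b * c)" by transfer (simp add: comp_P_def)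
  show "1 * a = a" by transfer (rule comp_P_id)
  show "a * 1 = a" by transfer (rule comp_P_id)
  show "a * (b + c) = a * b + a * c" by transfer (simp add: comp_P_def fun_eq_iff)
  show "(a + b) * c = a * c + b * c"
  proof (transfer, intro ext)
    fix f g h :: "'b \<Rightarrow> ('b set \<Rightarrow> 'a) \<Rightarrow> 'b set \<Rightarrow> 'a" and x v S
    assume "f \<in> Hom_P G_P G_P" "g \<in> Hom_P G_P G_P" and h: "h \<in> Hom_P G_P G_P"
    then have lin: "linear_between (scl G_P) (spc G_P x) (scl G_P) (spc G_P x) (f x)"
      "linear_between (scl G_P) (spc G_P x) (scl G_P) (spc G_P x) (g x)"
      "linear_between (scl G_P) (spc G_P x) (scl G_P) (spc G_P x) (h x)"
      by (auto simp: Hom_P_def)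
    have "h x (f x v + g x v) = h x (f x v) + h x (g x v)"
    proof (cases "v \<in> spc G_P x")
      case True
      then show ?thesis using lin unfolding linear_between_def by blast
    next
      case False
      then have "f x v = 0" "g x v = 0" using lin unfolding linear_between_def by blast+
      moreover have "h x 0 = 0" by (rule linear_between_0[OF lin(3)])
      ultimately show ?thesis by simp
    qed
    then show "comp_P h (f + g) x v S = (comp_P h f + comp_P h g) x v S"
      by (simp add: comp_P_def)
  qed
  show "(0 :: ('a, 'b) Lambda_P) \<noteq> 1"
  proof (transfer, rule notI)
    assume eq: "0 = (id_P G_P :: 'b \<Rightarrow> ('b set \<Rightarrow> 'a) \<Rightarrow> 'b set \<Rightarrow> 'a)"
    fix x :: 'b
    let ?v = "\<lambda>S. if S = {x} then 1 else (0 :: 'a)"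
    have "{x} \<in> intervals"
      by (auto simp: intervals_def poset_connected_def poset_convex_def)
    then have "?v \<in> spc G_P x"
      by (auto simp: G_P_def direct_sum_def Let_def interval_rep_def)
    then have "id_P G_P x ?v {x} = 1" by (simp add: id_P_def)
    then show False using eq by (metis zero_fun_def zero_neq_one)
  qed
qed

end

lift_definition scale_Lambda_P :: "'k::field \<Rightarrow> ('k, 'p::{finite,order}) Lambda_P \<Rightarrow> ('k, 'p) Lambda_P"
  is "\<lambda>c f x v S. c * f x v S"
  by (rule Hom_G_P_scale)

text \<open>A morphism \<open>f\<close> between the interval representations of \<open>R\<close> and \<open>S\<close>, viewed in \<open>\<Lambda>\<^sub>P\<close> via the
  projection onto the summand of \<open>R\<close> and the inclusion of the summand of \<open>S\<close>.\<close>

definition op_mor ::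
  "'p::{finite,order} set \<Rightarrow> 'p set \<Rightarrow> ('p \<Rightarrow> 'k::field \<Rightarrow> 'k) \<Rightarrow> ('k, 'p) Lambda_P" where
  "op_mor R S f = Abs_Lambda_P
     (comp_P (direct_sum_inj interval_rep S) (comp_P f (direct_sum_proj intervals interval_rep R)))"

definition e_idem :: "'p::{finite,order} set \<Rightarrow> ('k::field, 'p) Lambda_P" where
  "e_idem S = op_mor S S (id_P (interval_rep S :: ('k, 'p, 'k) rep))"

definition Lambda_P_plus :: "('k::field, 'p::{finite,order}) Lambda_P set" where
  "Lambda_P_plus = module.span scale_Lambda_P
     {op_mor R U (quot_map R U) | R U. R \<in> intervals \<and> U \<in> downset_intervals R}"

definition Lambda_P_minus :: "('k::field, 'p::{finite,order}) Lambda_P set" where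
  "Lambda_P_minus = module.span scale_Lambda_P
     {op_mor U S (incl_map U S) | U S. S \<in> intervals \<and> U \<in> upset_intervals S}"

text \<open>The arguments of \<open>Abs_Lambda_P\<close> in \<open>op_mor\<close> are endomorphisms of \<open>G_P\<close>.\<close>

lemma direct_sum_inj_Hom_P:
  assumes "S \<in> intervals"
  shows "direct_sum_inj interval_rep S \<in>
    Hom_P (interval_rep S :: ('k::field, 'p::order, 'k) rep) G_P"
  using assms
  by (auto simp: Hom_P_def linear_between_def direct_sum_inj_def G_P_def direct_sum_def Let_def
      interval_rep_def fun_eq_iff)

lemma direct_sum_proj_Hom_P:
  assumes "R \<in> intervals"
  shows "direct_sum_proj intervals interval_rep R \<in>
    Hom_P (G_P :: ('k::field, 'p::order, 'p set \<Rightarrow> 'k) rep) (interval_rep R)"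
proof -
  let ?G = "direct_sum intervals interval_rep :: ('k, 'p, 'p set \<Rightarrow> 'k) rep"
  have spc: "v \<in> spc ?G x \<longleftrightarrow> (\<forall>S. \<not> (S \<in> intervals \<and> x \<in> S) \<longrightarrow> v S = 0)" for x v
    by (auto simp: direct_sum_def Let_def interval_rep_def)
  have scl: "scl ?G c v S = c * v S" for c v S
    by (simp add: direct_sum_def Let_def interval_rep_def)
  have tr: "tr ?G x y v S = (if x \<in> S \<and> y \<in> S then v S else 0)" if "v \<in> spc ?G x" for x y v S
    using that by (auto simp: direct_sum_def Let_def interval_rep_def)
  show ?thesis
    using assms unfolding G_P_def
    by (auto simp: Hom_P_def linear_between_def direct_sum_proj_def interval_rep_def scl tr spc)
qed

lemma quot_map_Hom_P:
  assumes "U \<in> downset_intervals R"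
  shows "quot_map R U \<in> Hom_P (interval_rep R) (interval_rep U)"
  using assms
  by (auto simp: Hom_P_def linear_between_def quot_map_def interval_rep_def downset_intervals_def
      relative_downset_def)

lemma incl_map_Hom_P:
  assumes "U \<in> upset_intervals S"
  shows "incl_map U S \<in> Hom_P (interval_rep U) (interval_rep S)"
  using assms
  by (auto simp: Hom_P_def linear_between_def incl_map_def interval_rep_def upset_intervals_def
      relative_upset_def)

lemma Rep_op_mor:
  assumes "R \<in> intervals" "S \<in> intervals"
    "f \<in> Hom_P (interval_rep R :: ('k::field, 'p::{finite,order}, 'k) rep) (interval_rep S)"
  shows "Rep_Lambda_P (op_mor R S f) =
    comp_P (direct_sum_inj interval_rep S) (comp_P f (direct_sum_proj intervals interval_rep R))"
  unfolding op_mor_def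
  using assms(3) direct_sum_inj_Hom_P[OF assms(2)] direct_sum_proj_Hom_P[OF assms(1)]
  by (blast intro: Abs_Lambda_P_inverse Hom_P_comp)

lemma op_mor_mult:
  fixes f g :: "'p::{finite,order} \<Rightarrow> 'k::field \<Rightarrow> 'k"
  assumes "R \<in> intervals" "S \<in> intervals" "T \<in> intervals"
    and f: "f \<in> Hom_P (interval_rep R) (interval_rep S)"
    and g: "g \<in> Hom_P (interval_rep S) (interval_rep T)"
  shows "op_mor R S f * op_mor S T g = op_mor R T (comp_P g f)"
proof -
  let ?inj = "direct_sum_inj interval_rep" and ?proj = "direct_sum_proj intervals interval_rep"
  have "?inj S x a \<in> spc G_P x" if "a \<in> spc (interval_rep S) x" for x and a :: 'k
    using direct_sum_inj_Hom_P[OF assms(2)] that by (auto simp: Hom_P_def linear_between_def)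
  moreover have f_in: "f x a \<in> spc (interval_rep S) x" for x a
    using f by (cases "a \<in> spc (interval_rep R) x")
      (auto simp: Hom_P_def linear_between_def interval_rep_def)
  ultimately have "?proj S x (?inj S x (f x a)) = f x a" for x a
    by (simp add: direct_sum_proj_def direct_sum_inj_def G_P_def)
  then have "comp_P (comp_P (?inj T) (comp_P g (?proj S))) (comp_P (?inj S) (comp_P f (?proj R))) =
      comp_P (?inj T) (comp_P (comp_P g f) (?proj R))"
    by (simp add: comp_P_def)
  moreover have "comp_P g f \<in> Hom_P (interval_rep R) (interval_rep T)"
    by (rule Hom_P_comp[OF f g])
  ultimately show ?thesis
    using assms by (simp add: Rep_Lambda_P_inject[symmetric] times_Lambda_P.rep_eq Rep_op_mor)
qed

end

theory Submission
  imports Defs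
begin

text \<open>A morphism from the interval representation of \<open>R\<close> to that of \<open>S\<close> is a scalar function on
  \<open>R \<inter> S\<close>, constant along comparabilities, whose support is a relative downset in \<open>R\<close> and a relative
  upset in \<open>S\<close>. The connected components of the support are intervals \<open>U\<close> of the same kind, and two such
  \<open>U\<close> are equal or disjoint; so the composites of a projection from \<open>R\<close> to \<open>U\<close> with an inclusion of \<open>U\<close>
  into \<open>S\<close> form a basis of \<open>\<Lambda>\<^sub>P\<close>. The tensor product is spanned by the corresponding pure tensors, since
  those with different middle intervals vanish by balancing over the idempotents. This gives (R3).

  For the radical, fix a point \<open>x\<close>. The relation ``some morphism from \<open>R\<close> to \<open>S\<close> is nonzero at \<open>x\<close>''
  is a partial order on the intervals containing \<open>x\<close>. Hence the scalar
  by which an element acts from a summand to itself is multiplicative in the element, and an element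
  all of whose scalars vanish is nilpotent.\<close>

section \<open>Connected components in intervals\<close>

definition comparability :: "'p::order set \<Rightarrow> ('p \<times> 'p) set" where
  "comparability S = {(a, b). a \<in> S \<and> b \<in> S \<and> (a \<le> b \<or> b \<le> a)}"

lemma in_comparability_iff [simp]:
  "(x, y) \<in> comparability S \<longleftrightarrow> x \<in> S \<and> y \<in> S \<and> (x \<le> y \<or> y \<le> x)"
  by (simp add: comparability_def)

lemma poset_connected_iff:
  "poset_connected S \<longleftrightarrow> (\<forall>x\<in>S. \<forall>y\<in>S. (x, y) \<in> (comparability S)\<^sup>*)"
  unfolding poset_connected_def comparability_def ..

text \<open>Each step of a path goes up or down inside \<open>S\<close>, so a path starting in
  \<open>W\<close> never leaves \<open>W\<close>. Equalities between intervals are deduced from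
  this.\<close>

lemma poset_connected_clopen:
  assumes "poset_connected S" "relative_downset W S" "relative_upset W S" "W \<noteq> {}"
  shows "W = S"
proof -
  obtain x where x: "x \<in> W" using assms(4) by blast
  have "W \<subseteq> S" using assms(2) by (auto simp: relative_downset_def)
  have "y \<in> W" if "(x, y) \<in> (comparability S)\<^sup>*" for y
    using that
  proof (induction rule: rtrancl_induct)
    case (step y z)
    have "z \<in> S" "y \<le> z \<or> z \<le> y" using step.hyps(2) by auto
    then show ?case
      using assms(2,3) step.IH unfolding relative_downset_def relative_upset_def by blast
  qed (rule x)
  then show ?thesis
    using assms(1) x \<open>W \<subseteq> S\<close> unfolding poset_connected_iff by blast
qed

text \<open>\<open>U\<close> is the connected component of \<open>x\<close> in \<open>W\<close>. A
  point of \<open>R\<close> below \<open>U\<close>, or of \<open>S\<close> above \<open>U\<close>,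
  lies in \<open>W\<close> and is comparable to a point of \<open>U\<close>, so it belongs to the
  same component.\<close>

lemma clopen_component:
  fixes R S :: "'p::order set"
  assumes "poset_convex R" "relative_downset W R" "relative_upset W S" "x \<in> W"
  obtains U where "U \<in> downset_intervals R" "U \<in> upset_intervals S" "x \<in> U"
proof -
  define U where "U = {y. (x, y) \<in> (comparability W)\<^sup>*}"
  have x: "x \<in> U" by (simp add: U_def)
  have "y \<in> W" if "(x, y) \<in> (comparability W)\<^sup>*" for y
    using that assms(4) by cases auto
  then have UW: "U \<subseteq> W" by (auto simp: U_def)
  have step: "z \<in> U" if "y \<in> U" "z \<in> W" "y \<le> z \<or> z \<le> y" for y z
  proof -
    have "y \<in> W" using that(1) UW by blast
    then have "(y, z) \<in> comparability W" using that by simp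
    moreover have "(x, y) \<in> (comparability W)\<^sup>*" using that(1) by (simp add: U_def)
    ultimately show ?thesis
      unfolding U_def mem_Collect_eq by (rule rtrancl.rtrancl_into_rtrancl[rotated])
  qed
  \<comment> \<open>Connectedness of \<open>U\<close> asks for paths inside \<open>U\<close>; a path
    in \<open>W\<close> from \<open>x\<close> visits only points reachable from \<open>x\<close>,
    that is, points of \<open>U\<close>.\<close>
  have path: "(x, y) \<in> (comparability U)\<^sup>*" if "(x, y) \<in> (comparability W)\<^sup>*" for y
    using that
  proof (induction rule: rtrancl_induct)
    case (step y z)
    have "y \<in> U" using step.hyps(1) by (simp add: U_def)
    moreover have "z \<in> U"
      using step.hyps unfolding U_def mem_Collect_eq by (rule rtrancl.rtrancl_into_rtrancl)
    ultimately have "(y, z) \<in> comparability U" using step.hyps(2) by simp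
    then show ?case using step.IH by (rule rtrancl.rtrancl_into_rtrancl[rotated])
  qed simp
  have "sym ((comparability U)\<^sup>*)" by (intro sym_rtrancl symI) auto
  then have conn: "poset_connected U"
    unfolding poset_connected_iff
  proof (intro ballI)
    fix y z assume "y \<in> U" "z \<in> U"
    then have "(x, y) \<in> (comparability U)\<^sup>*" "(x, z) \<in> (comparability U)\<^sup>*"
      using path by (simp_all add: U_def)
    then show "(y, z) \<in> (comparability U)\<^sup>*"
      using \<open>sym _\<close> by (meson rtrancl_trans symD)
  qed
  have down: "relative_downset U R"
    unfolding relative_downset_def
  proof (intro conjI ballI impI)
    show "U \<subseteq> R" using UW assms(2) by (auto simp: relative_downset_def)
    show "y \<in> U" if "c \<in> U" "y \<in> R" "y \<le> c" for c y
      using that UW assms(2) by (intro step[of c y]) (auto simp: relative_downset_def)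
  qed
  have up: "relative_upset U S"
    unfolding relative_upset_def
  proof (intro conjI ballI impI)
    show "U \<subseteq> S" using UW assms(3) by (auto simp: relative_upset_def)
    show "y \<in> U" if "c \<in> U" "y \<in> S" "c \<le> y" for c y
      using that UW assms(3) by (intro step[of c y]) (auto simp: relative_upset_def)
  qed
  \<comment> \<open>A point between two points of \<open>U\<close> lies in \<open>R\<close> by
    convexity and below a point of \<open>U\<close>.\<close>
  have "poset_convex U"
    using down assms(1) unfolding poset_convex_def relative_downset_def by blast
  then have "U \<in> intervals" using x conn by (auto simp: intervals_def)
  then show ?thesis
    using that down up x by (auto simp: downset_intervals_def upset_intervals_def)
qed

text \<open>\<open>U \<inter> V\<close> contains \<open>x\<close> and is both a relative downset and
  a relative upset in \<open>U\<close> and in \<open>V\<close>, so connectedness makes it equal to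
  both.\<close>

lemma downset_upset_intervals_disjoint:
  assumes "U \<in> downset_intervals R" "U \<in> upset_intervals S"
    and "V \<in> downset_intervals R" "V \<in> upset_intervals S" and "x \<in> U" "x \<in> V"
  shows "U = V"
proof -
  have sub: "A \<inter> B = A"
    if "A \<in> downset_intervals R" "A \<in> upset_intervals S"
      "B \<in> downset_intervals R" "B \<in> upset_intervals S" "x \<in> A" "x \<in> B" for A B
  proof (rule poset_connected_clopen)
    show "poset_connected A" using that by (simp add: downset_intervals_def intervals_def)
    show "relative_downset (A \<inter> B) A"
      using that by (auto simp: downset_intervals_def relative_downset_def)
    show "relative_upset (A \<inter> B) A"
      using that by (auto simp: upset_intervals_def relative_upset_def)
  qed (use that in auto)
  show ?thesis using sub[of U V] sub[of V U] assms by blast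
qed

section \<open>Closure properties of relative downsets and upsets\<close>

lemma interval_in_downset_intervals: "S \<in> intervals \<Longrightarrow> S \<in> downset_intervals S"
  by (auto simp: downset_intervals_def relative_downset_def)

lemma interval_in_upset_intervals: "S \<in> intervals \<Longrightarrow> S \<in> upset_intervals S"
  by (auto simp: upset_intervals_def relative_upset_def)

lemma downset_intervals_trans:
  "T \<in> downset_intervals S \<Longrightarrow> S \<in> downset_intervals R \<Longrightarrow> T \<in> downset_intervals R"
  by (fastforce simp: downset_intervals_def relative_downset_def)

lemma upset_intervals_trans:
  "R \<in> upset_intervals S \<Longrightarrow> S \<in> upset_intervals T \<Longrightarrow> R \<in> upset_intervals T"
  by (fastforce simp: upset_intervals_def relative_upset_def)

lemma relative_downsetD:
  "relative_downset W R \<Longrightarrow> c \<in> W \<Longrightarrow> y \<in> R \<Longrightarrow> y \<le> c \<Longrightarrow> y \<in> W"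
  unfolding relative_downset_def by blast

lemma relative_upsetD:
  "relative_upset W R \<Longrightarrow> c \<in> W \<Longrightarrow> y \<in> R \<Longrightarrow> c \<le> y \<Longrightarrow> y \<in> W"
  unfolding relative_upset_def by blast

lemma relative_downset_subset: "relative_downset W R \<Longrightarrow> W \<subseteq> R"
  unfolding relative_downset_def by blast

lemma relative_upset_subset: "relative_upset W R \<Longrightarrow> W \<subseteq> R"
  unfolding relative_upset_def by blast

text \<open>If morphisms from \<open>R\<close> to \<open>S\<close> and from \<open>S\<close> to
  \<open>T\<close> have supports \<open>W\<close> and \<open>V\<close>, their composite has support
  \<open>W \<inter> V\<close>. This lemma and \<open>relative_upset_Int\<close> provide the
  transitivity of \<open>interval_le\<close>.\<close>

lemma relative_downset_Int:
  assumes "relative_downset W R" "W \<subseteq> S" "relative_downset V S"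
  shows "relative_downset (W \<inter> V) R"
  unfolding relative_downset_def
proof (intro conjI ballI impI)
  show "W \<inter> V \<subseteq> R" using assms(1) by (auto simp: relative_downset_def)
  fix c y assume c: "c \<in> W \<inter> V" and y: "y \<in> R" "y \<le> c"
  then have "y \<in> W" using relative_downsetD[OF assms(1)] by blast
  then show "y \<in> W \<inter> V" using relative_downsetD[OF assms(3), of c y] assms(2) c y(2) by blast
qed

lemma relative_upset_Int:
  assumes "relative_upset V T" "V \<subseteq> S" "relative_upset W S"
  shows "relative_upset (W \<inter> V) T"
  unfolding relative_upset_def
proof (intro conjI ballI impI)
  show "W \<inter> V \<subseteq> T" using assms(1) by (auto simp: relative_upset_def)
  fix c y assume c: "c \<in> W \<inter> V" and y: "y \<in> T" "c \<le> y"
  then have "y \<in> V" using relative_upsetD[OF assms(1)] by blast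
  then show "y \<in> W \<inter> V" using relative_upsetD[OF assms(3), of c y] assms(2) c y(2) by blast
qed

text \<open>\<open>interval_le x R S\<close> says that some morphism from the interval representation of \<open>R\<close> to that
  of \<open>S\<close> is nonzero at \<open>x\<close>.\<close>

definition interval_le :: "'p::order \<Rightarrow> 'p set \<Rightarrow> 'p set \<Rightarrow> bool" where
  "interval_le x R S \<longleftrightarrow> R \<in> intervals \<and> S \<in> intervals \<and>
     (\<exists>W. x \<in> W \<and> relative_downset W R \<and> relative_upset W S)"

lemma interval_le_trans:
  assumes "interval_le x R S" "interval_le x S T"
  shows "interval_le x R T"
proof -
  obtain W V where "x \<in> W" "relative_downset W R" "relative_upset W S"
    "x \<in> V" "relative_downset V S" "relative_upset V T"
    using assms unfolding interval_le_def by blast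
  note WV = this
  have "relative_downset (W \<inter> V) R"
    by (rule relative_downset_Int[OF WV(2) relative_upset_subset[OF WV(3)] WV(5)])
  moreover have "relative_upset (W \<inter> V) T"
    by (rule relative_upset_Int[OF WV(6) relative_downset_subset[OF WV(5)] WV(3)])
  ultimately show ?thesis using assms WV(1,4) unfolding interval_le_def by blast
qed

text \<open>For witnesses \<open>W\<close> and \<open>V\<close> of the two relations,
  \<open>W \<inter> V\<close> is a relative downset and upset in both \<open>R\<close> and
  \<open>S\<close>, hence equal to each by connectedness.\<close>

lemma interval_le_antisym:
  assumes "interval_le x R S" "interval_le x S R"
  shows "R = S"
proof -
  obtain W V where W: "x \<in> W" "relative_downset W R" "relative_upset W S"
    and V: "x \<in> V" "relative_downset V S" "relative_upset V R"
    using assms unfolding interval_le_def by blast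
  have conn: "poset_connected R" "poset_connected S"
    using assms by (simp_all add: interval_le_def intervals_def)
  have ne: "W \<inter> V \<noteq> {}" using W(1) V(1) by blast
  note sub = relative_downset_subset[OF W(2)] relative_upset_subset[OF W(3)]
    relative_downset_subset[OF V(2)] relative_upset_subset[OF V(3)]
  have "W \<inter> V = R"
    by (rule poset_connected_clopen[OF conn(1) relative_downset_Int[OF W(2) sub(2) V(2)]
          relative_upset_Int[OF V(3) sub(3) W(3)] ne])
  moreover have "V \<inter> W = S"
    by (rule poset_connected_clopen[OF conn(2) relative_downset_Int[OF V(2) sub(4) W(2)]
          relative_upset_Int[OF W(3) sub(1) V(3)]]) (use ne in blast)
  ultimately show ?thesis by blast
qed

text \<open>The rank bounds the number of strict steps in a chain ending at \<open>S\<close> in the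
  order at \<open>x\<close>; nilpotency will come from this bound.\<close>

definition interval_rank :: "'p::{finite,order} \<Rightarrow> 'p set \<Rightarrow> nat" where
  "interval_rank x S = card {T. T \<noteq> S \<and> interval_le x T S}"

lemma interval_rank_less:
  assumes "interval_le x T S" "T \<noteq> S"
  shows "interval_rank x T < interval_rank x S"
  unfolding interval_rank_def
proof (rule psubset_card_mono)
  show "{V. V \<noteq> T \<and> interval_le x V T} \<subset> {V. V \<noteq> S \<and> interval_le x V S}"
    using assms interval_le_trans interval_le_antisym by blast
qed simp

section \<open>Entries of endomorphisms of \<open>G_P\<close>\<close>

lemma in_spc_G_P_iff:
  fixes v :: "'p::order set \<Rightarrow> 'k::field"
  shows "v \<in> spc G_P x \<longleftrightarrow> (\<forall>S. \<not> (S \<in> intervals \<and> x \<in> S) \<longrightarrow> v S = 0)"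
  by (auto simp: G_P_def direct_sum_def Let_def interval_rep_def)

lemma tr_G_P:
  fixes v :: "'p::order set \<Rightarrow> 'k::field"
  assumes "v \<in> spc G_P x"
  shows "tr G_P x y v = (\<lambda>S. if x \<in> S \<and> y \<in> S then v S else 0)"
  using assms by (auto simp: G_P_def direct_sum_def Let_def interval_rep_def fun_eq_iff)

text \<open>The component at \<open>x\<close> of the part of \<open>a\<close> that goes from the summand of \<open>R\<close> to that of \<open>S\<close> is
  multiplication by \<open>entry a R S x\<close>.\<close>

definition entry :: "('k::field, 'p::{finite,order}) Lambda_P \<Rightarrow> 'p set \<Rightarrow> 'p set \<Rightarrow> 'p \<Rightarrow> 'k" where
  "entry a R S x = Rep_Lambda_P a x (\<lambda>T. of_bool (T = R)) S"

lemma Rep_Lambda_P_linear: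
  "linear_between (scl G_P) (spc G_P x) (scl G_P) (spc G_P x) (Rep_Lambda_P a x)"
  using Rep_Lambda_P[of a] by (simp add: Hom_P_def)

lemma Rep_Lambda_P_outside: "v \<notin> spc G_P x \<Longrightarrow> Rep_Lambda_P a x v = 0"
  using Rep_Lambda_P_linear[of x a] unfolding linear_between_def by blast

lemma Rep_Lambda_P_in: "Rep_Lambda_P a x v \<in> spc G_P x"
  using Rep_Lambda_P_linear[of x a]
  by (cases "v \<in> spc G_P x") (auto simp: linear_between_def in_spc_G_P_iff)

lemma of_bool_in_spc_G_P_iff:
  "(\<lambda>T. of_bool (T = R) :: 'k::field) \<in> spc G_P x \<longleftrightarrow> R \<in> intervals \<and> x \<in> R"
  by (auto simp: in_spc_G_P_iff)

text \<open>An encoded map is \<open>0\<close> outside its domain, which forces the unit vector at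
  \<open>R\<close> into the fibre at \<open>x\<close>; the conditions on \<open>S\<close> hold
  because the image lies in that fibre.\<close>

lemma entry_nonzeroD:
  fixes a :: "('k::field, 'p::{finite,order}) Lambda_P"
  assumes "entry a R S x \<noteq> 0"
  shows "R \<in> intervals" "S \<in> intervals" "x \<in> R" "x \<in> S"
proof -
  have "(\<lambda>T. of_bool (T = R)) \<in> spc (G_P :: ('k, 'p, 'p set \<Rightarrow> 'k) rep) x"
    by (rule ccontr) (use assms in \<open>simp add: entry_def Rep_Lambda_P_outside\<close>)
  then show "R \<in> intervals" "x \<in> R" by (simp_all add: of_bool_in_spc_G_P_iff)
  show "S \<in> intervals" "x \<in> S"
    using assms Rep_Lambda_P_in[of a x] by (auto simp: in_spc_G_P_iff entry_def)
qed

text \<open>The matrix form of \<open>a\<close> at \<open>x\<close>, through which entries determine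
  elements and products.\<close>

lemma Rep_Lambda_P_eq_sum:
  fixes a :: "('k::field, 'p::{finite,order}) Lambda_P"
  assumes v: "v \<in> spc G_P x"
  shows "Rep_Lambda_P a x v S = (\<Sum>T\<in>UNIV. v T * entry a T S x)"
proof -
  let ?f = "Rep_Lambda_P a x"
  note lin = Rep_Lambda_P_linear[of x a]
  have scl: "scl G_P c w = (\<lambda>S. c * w S)" for c :: 'k and w :: "'p set \<Rightarrow> 'k"
    by (simp add: fun_eq_iff)
  have scale: "?f (scl G_P c w) = scl G_P c (?f w)" if "w \<in> spc G_P x" for c w
    using lin that unfolding linear_between_def by blast
  \<comment> \<open>The vector is cut down to the coordinates in \<open>F\<close>, and
    \<open>F\<close> grows by induction.\<close>
  have "?f (\<lambda>T. of_bool (T \<in> F) * v T) S = (\<Sum>T\<in>F. v T * entry a T S x)" for F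
  proof (induction F rule: infinite_finite_induct)
    case empty
    show ?case using linear_between_0[OF lin] by (simp add: zero_fun_def)
  next
    case (insert T F)
    show ?case
    \<comment> \<open>Additivity is available only on the fibre at \<open>x\<close>, and
      \<open>v T \<noteq> 0\<close> ensures that the unit vector at \<open>T\<close> lies
      there.\<close>
    proof (cases "v T = 0")
      case True
      then have "(\<lambda>U. of_bool (U \<in> insert T F) * v U) = (\<lambda>U. of_bool (U \<in> F) * v U)"
        by (auto simp: fun_eq_iff)
      then show ?thesis using insert True by simp
    next
      case False
      let ?d = "\<lambda>U. of_bool (U = T) :: 'k"
      have d: "?d \<in> spc G_P x" using False v by (auto simp: in_spc_G_P_iff)
      have vd: "(\<lambda>U. v T * ?d U) \<in> spc G_P x" using d by (auto simp: in_spc_G_P_iff)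
      have F: "(\<lambda>U. of_bool (U \<in> F) * v U) \<in> spc G_P x" using v by (auto simp: in_spc_G_P_iff)
      have "(\<lambda>U. of_bool (U \<in> insert T F) * v U) = (\<lambda>U. v T * ?d U) + (\<lambda>U. of_bool (U \<in> F) * v U)"
        using insert by (auto simp: fun_eq_iff)
      moreover have "?f ((\<lambda>U. v T * ?d U) + (\<lambda>U. of_bool (U \<in> F) * v U)) =
          ?f (\<lambda>U. v T * ?d U) + ?f (\<lambda>U. of_bool (U \<in> F) * v U)"
        using lin vd F unfolding linear_between_def by blast
      moreover have "?f (\<lambda>U. v T * ?d U) = (\<lambda>U. v T * ?f ?d U)"
        using scale[OF d, of "v T"] by (simp only: scl)
      ultimately show ?thesis using insert by (simp add: entry_def)
    qed
  qed simp
  from this[of UNIV] show ?thesis by simp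
qed

lemma entry_eqI:
  assumes "\<And>R S x. entry a R S x = entry b R S x"
  shows "a = b"
proof -
  have "Rep_Lambda_P a x v = Rep_Lambda_P b x v" for x v
  proof (cases "v \<in> spc G_P x")
    case True
    then show ?thesis using assms by (auto simp: fun_eq_iff Rep_Lambda_P_eq_sum)
  next
    case False
    then show ?thesis by (simp add: Rep_Lambda_P_outside)
  qed
  then have "Rep_Lambda_P a = Rep_Lambda_P b" by (intro ext) simp
  then show ?thesis by (simp add: Rep_Lambda_P_inject)
qed

section \<open>Entries of the algebra operations\<close>

lemma entry_0 [simp]: "entry 0 R S x = 0"
  by (simp add: entry_def zero_Lambda_P.rep_eq)

lemma entry_add [simp]: "entry (a + b) R S x = entry a R S x + entry b R S x"
  by (simp add: entry_def plus_Lambda_P.rep_eq)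

lemma entry_diff [simp]: "entry (a - b) R S x = entry a R S x - entry b R S x"
  by (simp add: entry_def minus_Lambda_P.rep_eq)

lemma entry_scale [simp]: "entry (scale_Lambda_P c a) R S x = c * entry a R S x"
  by (simp add: entry_def scale_Lambda_P.rep_eq)

lemma entry_sum: "entry (\<Sum>i\<in>I. a i) R S x = (\<Sum>i\<in>I. entry (a i) R S x)"
  by (induction I rule: infinite_finite_induct) simp_all

lemma entry_one: "entry 1 R S x = of_bool (R = S \<and> R \<in> intervals \<and> x \<in> R)"
  by (auto simp: entry_def one_Lambda_P.rep_eq id_P_def of_bool_in_spc_G_P_iff)

text \<open>In the opposite algebra the left factor acts first, so entries multiply like matrices in
  the usual order.\<close>

lemma entry_mult: "entry (a * b) R S x = (\<Sum>T\<in>UNIV. entry a R T x * entry b T S x)"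
  by (simp add: entry_def[of "a * b"] times_Lambda_P.rep_eq comp_P_def
      Rep_Lambda_P_eq_sum[OF Rep_Lambda_P_in] entry_def[of a])

text \<open>The naturality square for \<open>x \<le> y\<close>, evaluated at the unit vector at
  \<open>R\<close>. The conditionals record that the structure maps vanish once \<open>y\<close>
  leaves the interval.\<close>

lemma entry_natural:
  fixes a :: "('k::field, 'p::{finite,order}) Lambda_P"
  assumes "x \<le> y" "x \<in> R"
  shows "(if y \<in> R then entry a R S y else 0) = (if y \<in> S then entry a R S x else 0)"
proof (cases "R \<in> intervals")
  case True
  let ?d = "\<lambda>T. of_bool (T = R) :: 'k"
  have d: "?d \<in> spc G_P x" using True assms by (simp add: of_bool_in_spc_G_P_iff)
  have "Rep_Lambda_P a y (tr G_P x y ?d) S = tr G_P x y (Rep_Lambda_P a x ?d) S"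
    using Rep_Lambda_P[of a] d assms(1) by (simp add: Hom_P_def)
  moreover have "tr G_P x y ?d = (if y \<in> R then ?d else 0)"
    using assms(2) by (auto simp: tr_G_P[OF d] fun_eq_iff)
  moreover have "tr G_P x y (Rep_Lambda_P a x ?d) S =
      (if y \<in> S then entry a R S x else 0)"
    using entry_nonzeroD(4)[of a R S x]
    by (auto simp: tr_G_P[OF Rep_Lambda_P_in] entry_def)
  ultimately show ?thesis
    using linear_between_0[OF Rep_Lambda_P_linear[of y a]] by (auto simp: entry_def split: if_splits)
next
  case False
  then have "entry a R S z = 0" for z using entry_nonzeroD(1)[of a R S z] by blast
  then show ?thesis by simp
qed

section \<open>Supports and constancy of morphisms\<close>

lemma relative_downset_entry: "relative_downset {x. entry a R S x \<noteq> 0} R"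
  unfolding relative_downset_def
proof (intro conjI ballI impI)
  show "{x. entry a R S x \<noteq> 0} \<subseteq> R" using entry_nonzeroD(3) by blast
  show "x \<in> {x. entry a R S x \<noteq> 0}" if "y \<in> {x. entry a R S x \<noteq> 0}" "x \<in> R" "x \<le> y" for x y
    using that entry_natural[of x y R a S] entry_nonzeroD[of a R S y] by auto
qed

lemma relative_upset_entry: "relative_upset {x. entry a R S x \<noteq> 0} S"
  unfolding relative_upset_def
proof (intro conjI ballI impI)
  show "{x. entry a R S x \<noteq> 0} \<subseteq> S" using entry_nonzeroD(4) by blast
  show "y \<in> {x. entry a R S x \<noteq> 0}" if "x \<in> {x. entry a R S x \<noteq> 0}" "y \<in> S" "x \<le> y" for x y
    using that entry_natural[of x y R a S] entry_nonzeroD[of a R S x] by (auto split: if_splits)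
qed

lemma entry_interval_le:
  assumes "entry a R S x \<noteq> 0"
  shows "interval_le x R S"
  unfolding interval_le_def
proof (intro conjI exI)
  show "x \<in> {y. entry a R S y \<noteq> 0}" using assms by simp
qed (fact entry_nonzeroD[OF assms] relative_downset_entry relative_upset_entry)+

lemma entry_constant:
  assumes "poset_connected U" "U \<subseteq> R" "U \<subseteq> S" "x \<in> U" "y \<in> U"
  shows "entry a R S x = entry a R S y"
proof -
  have "(x, y) \<in> (comparability U)\<^sup>*"
    using assms unfolding poset_connected_iff by blast
  then show ?thesis
  proof (induction rule: rtrancl_induct)
    case (step y z)
    have "y \<in> R" "z \<in> R" "y \<in> S" "z \<in> S" "y \<le> z \<or> z \<le> y"
      using step.hyps(2) assms(2,3) by auto
    then have "entry a R S y = entry a R S z"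
      using entry_natural[of y z R a S] entry_natural[of z y R a S] by auto
    then show ?case using step.IH by simp
  qed simp
qed

lemma entry_op_mor:
  fixes f :: "'p::{finite,order} \<Rightarrow> 'k::field \<Rightarrow> 'k"
  assumes "A \<in> intervals" "B \<in> intervals" and f: "f \<in> Hom_P (interval_rep A) (interval_rep B)"
  shows "entry (op_mor A B f) R S x = (if R = A \<and> S = B \<and> x \<in> A then f x 1 else 0)"
proof -
  have lin: "linear_between (*) (spc (interval_rep A :: ('k, 'p, 'k) rep) x)
      (*) (spc (interval_rep B :: ('k, 'p, 'k) rep) x) (f x)"
    using f by (simp add: Hom_P_def interval_rep_def)
  have f0: "f x 0 = 0" by (rule linear_between_0[OF lin])
  have fin: "f x c \<in> spc (interval_rep B :: ('k, 'p, 'k) rep) x" for c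
    using lin by (cases "c \<in> spc (interval_rep A :: ('k, 'p, 'k) rep) x")
      (auto simp: linear_between_def interval_rep_def)
  have "direct_sum_proj intervals interval_rep A x (\<lambda>T. of_bool (T = R)) =
      (of_bool (R = A \<and> x \<in> A) :: 'k)"
    using assms(1) of_bool_in_spc_G_P_iff[of R x, where 'k='k]
    unfolding G_P_def by (auto simp: direct_sum_proj_def)
  then show ?thesis
    using fin f0 assms
    by (auto simp: entry_def Rep_op_mor comp_P_def direct_sum_inj_def)
qed

section \<open>The Jacobson radical\<close>

text \<open>Provides a left inverse of \<open>1 - a\<close> when \<open>a\<close> is
  nilpotent.\<close>

lemma left_geometric_sum:
  fixes a :: "'a::ring_1"
  shows "(\<Sum>i<n. a ^ i) * (1 - a) = 1 - a ^ n"
proof (induction n)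
  case (Suc n)
  have "(\<Sum>i<Suc n. a ^ i) * (1 - a) = (\<Sum>i<n. a ^ i) * (1 - a) + a ^ n * (1 - a)"
    by (simp only: sum.lessThan_Suc distrib_right)
  also have "\<dots> = 1 - a ^ n + (a ^ n - a ^ n * a)"
    unfolding Suc.IH by (simp only: right_diff_distrib mult_1_right)
  finally show ?case by (simp only: power_Suc2) simp
qed simp

text \<open>If \<open>N\<close> were not inside a maximal left ideal \<open>I\<close>, then
  \<open>I + N\<close> would be everything and \<open>1 = i + a\<close> with \<open>a\<close>
  nilpotent. But then \<open>i = 1 - a\<close> has a left inverse, so
  \<open>1 \<in> I\<close>.\<close>

lemma nil_left_ideal_subset_jacobson_radical:
  fixes N :: "'a::ring_1 set"
  assumes N: "left_ideal N" and nil: "\<And>a. a \<in> N \<Longrightarrow> \<exists>n. a ^ n = 0"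
  shows "N \<subseteq> jacobson_radical"
  unfolding jacobson_radical_def
proof (intro Inter_greatest)
  fix I :: "'a set" assume "I \<in> {I. maximal_left_ideal I}"
  then have I: "left_ideal I" "I \<noteq> UNIV"
    and max: "\<And>J. left_ideal J \<Longrightarrow> I \<subseteq> J \<Longrightarrow> J = I \<or> J = UNIV"
    by (auto simp: maximal_left_ideal_def)
  have J: "left_ideal (I + N)"
    unfolding left_ideal_def
  proof (intro conjI ballI allI)
    show "0 \<in> I + N"
      using I(1) N set_plus_intro[of 0 I 0 N] by (simp add: left_ideal_def)
    show "x + y \<in> I + N" if xy: "x \<in> I + N" "y \<in> I + N" for x y
    proof -
      obtain i n i' n' where "x = i + n" "y = i' + n'" and in': "i \<in> I" "n \<in> N" "i' \<in> I" "n' \<in> N"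
        using set_plus_elim[OF xy(1)] set_plus_elim[OF xy(2)] by metis
      then have "x + y = (i + i') + (n + n')" by (simp add: algebra_simps)
      moreover have "i + i' \<in> I" "n + n' \<in> N" using I(1) N in' by (auto simp: left_ideal_def)
      ultimately show ?thesis by (metis set_plus_intro)
    qed
    show "a * x \<in> I + N" if x: "x \<in> I + N" for a x
    proof -
      obtain i n where "x = i + n" "i \<in> I" "n \<in> N" using set_plus_elim[OF x] by metis
      moreover have "a * i \<in> I" "a * n \<in> N"
        using I(1) N calculation(2,3) by (auto simp: left_ideal_def)
      ultimately show ?thesis by (simp add: distrib_left set_plus_intro)
    qed
  qed
  have sub: "I \<subseteq> I + N" "N \<subseteq> I + N"
    using set_plus_intro[of _ I 0 N] set_plus_intro[of 0 I _ N] I(1) N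
    unfolding left_ideal_def by fastforce+
  have "I + N \<noteq> UNIV"
  proof
    assume "I + N = UNIV"
    then have one: "1 \<in> I + N" by blast
    obtain i a where ia: "1 = i + a" "i \<in> I" "a \<in> N"
      using set_plus_elim[OF one] by metis
    obtain n where n: "a ^ n = 0" using nil ia(3) by blast
    have "i = 1 - a" using ia(1) by (simp add: eq_diff_eq)
    then have "(\<Sum>k<n. a ^ k) * i = 1" using left_geometric_sum[of a n] n by simp
    then have "1 \<in> I" using I(1) ia(2) by (metis left_ideal_def)
    then have "x \<in> I" for x using I(1) by (metis left_ideal_def mult.right_neutral)
    then show False using I(2) by blast
  qed
  then show "N \<subseteq> I" using max[OF J sub(1)] sub(2) by blast
qed

text \<open>An element outside the kernel can be scaled to have value \<open>1\<close>. It then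
  differs from \<open>1\<close> by a kernel element, so a larger left ideal contains
  \<open>1\<close>.\<close>

lemma (in k_algebra) maximal_left_ideal_character_kernel:
  assumes add: "\<And>a b. \<chi> (a + b) = \<chi> a + \<chi> b" and mult: "\<And>a b. \<chi> (a * b) = \<chi> a * \<chi> b"
    and scale: "\<And>c a. \<chi> (c *s a) = c * \<chi> a" and one: "\<chi> 1 = (1 :: 'k)"
  shows "maximal_left_ideal {a. \<chi> a = 0}"
  unfolding maximal_left_ideal_def
proof (intro conjI allI impI)
  have zero: "\<chi> 0 = 0" using scale[of 0 0] by simp
  then show "left_ideal {a. \<chi> a = 0}" by (simp add: left_ideal_def add mult)
  show "{a. \<chi> a = 0} \<noteq> UNIV" using one by (metis UNIV_I mem_Collect_eq zero_neq_one)
  fix J :: "'a set" assume J: "left_ideal J" "{a. \<chi> a = 0} \<subseteq> J"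
  have "J = UNIV" if a: "a \<in> J" "\<chi> a \<noteq> 0" for a
  proof -
    let ?b = "(1 / \<chi> a) *s a"
    \<comment> \<open>\<open>left_ideal\<close> speaks only of ring multiplication, so scaling is
      written as left multiplication by a multiple of \<open>1\<close>.\<close>
    have "?b = ((1 / \<chi> a) *s 1) * a" by (simp add: mult_scale_left)
    then have b: "?b \<in> J" using J(1) a(1) by (metis left_ideal_def)
    have "\<chi> (1 - ?b) + \<chi> ?b = 1" using add[of "1 - ?b" ?b] one by simp
    then have "\<chi> (1 - ?b) = 0" using a(2) by (simp add: scale)
    then have "(1 - ?b) + ?b \<in> J" using J b unfolding left_ideal_def by blast
    then have "1 \<in> J" by simp
    then show ?thesis using J(1) by (metis UNIV_eq_I left_ideal_def mult.right_neutral)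
  qed
  then show "J = {a. \<chi> a = 0} \<or> J = UNIV" using J(2) by blast
qed

text \<open>Serves for the cosets of the radical as well as for those of the tensor
  relations.\<close>

lemma elt_set_plus_eq_iff:
  fixes J :: "'a::ab_group_add set"
  assumes "0 \<in> J" and diff: "\<And>x y. x \<in> J \<Longrightarrow> y \<in> J \<Longrightarrow> x - y \<in> J"
  shows "f +o J = g +o J \<longleftrightarrow> f - g \<in> J"
proof
  have mem: "h \<in> f +o J \<longleftrightarrow> h - f \<in> J" for h f
    by (force simp: elt_set_plus_def)
  show "f - g \<in> J" if "f +o J = g +o J"
  proof -
    have "f \<in> f +o J" using assms(1) by (simp add: mem)
    then show ?thesis using that by (simp add: mem)
  qed
  show "f +o J = g +o J" if fg: "f - g \<in> J"
  proof (intro set_eqI)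
    fix h
    show "h \<in> f +o J \<longleftrightarrow> h \<in> g +o J"
      \<comment> \<open>\<open>h - f = (h - g) - (f - g)\<close>, and conversely
        \<open>h - g = (h - f) - (0 - (f - g))\<close>.\<close>
      using diff[OF _ fg, of "h - g"] diff[OF _ diff[OF assms(1) fg], of "h - f"]
      by (auto simp: mem)
  qed
qed

section \<open>The multiplication map of a tensor product\<close>

interpretation free: vector_space free_scale
  by (rule vector_space_free_scale)

text \<open>Padding with zero coefficients lets several formal sums share one index set, as
  additivity requires.\<close>

lemma (in k_algebra) free_mult_eq_sum:
  assumes "finite X" "Poly_Mapping.keys f \<subseteq> X"
  shows "free_mult f = (\<Sum>p\<in>X. Poly_Mapping.lookup f p *s (fst p * snd p))"
proof -
  have "free_mult f = (\<Sum>p\<in>Poly_Mapping.keys f. Poly_Mapping.lookup f p *s (fst p * snd p))"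
    by (simp add: free_mult_def case_prod_beta)
  also have "\<dots> = (\<Sum>p\<in>X. Poly_Mapping.lookup f p *s (fst p * snd p))"
    using assms by (intro sum.mono_neutral_left) (auto simp: in_keys_iff)
  finally show ?thesis .
qed

lemma (in k_algebra) free_mult_linear: "Vector_Spaces.linear free_scale scale free_mult"
proof (unfold_locales)
  fix f g :: "'a \<times> 'a \<Rightarrow>\<^sub>0 'k" and c
  let ?X = "Poly_Mapping.keys f \<union> Poly_Mapping.keys g"
  have "Poly_Mapping.keys (f + g) \<subseteq> ?X" by (rule keys_add)
  then show "free_mult (f + g) = free_mult f + free_mult g"
    by (simp add: free_mult_eq_sum[where X = ?X] lookup_add scale_left_distrib sum.distrib)
  have "Poly_Mapping.keys (free_scale c f) \<subseteq> Poly_Mapping.keys f"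
    by (auto simp: in_keys_iff)
  then show "free_mult (free_scale c f) = c *s free_mult f"
    by (simp add: free_mult_eq_sum[where X = "Poly_Mapping.keys f"] scale_sum_right)
qed

lemma (in k_algebra) free_mult_free_gen [simp]: "free_mult (free_gen m n) = m * n"
  by (simp add: free_mult_def)

text \<open>Allows induction over linear combinations of pure generators.\<close>

lemma free_space_eq_span:
  "free_space (X :: 'b set) = free.span ((\<lambda>b. Poly_Mapping.single b (1 :: 'k::field)) ` X)"
proof
  show "free_space X \<subseteq> free.span ((\<lambda>b. Poly_Mapping.single b (1 :: 'k)) ` X)"
  proof
    fix f :: "'b \<Rightarrow>\<^sub>0 'k" assume f: "f \<in> free_space X"
    have "f = (\<Sum>b\<in>Poly_Mapping.keys f. free_scale (Poly_Mapping.lookup f b) (Poly_Mapping.single b 1))"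
      by (rule poly_mapping_eqI)
        (auto simp: lookup_sum lookup_single when_def in_keys_iff if_distrib cong: if_cong)
    moreover have "\<dots> \<in> free.span ((\<lambda>b. Poly_Mapping.single b (1 :: 'k)) ` X)"
      using f by (intro free.span_sum free.span_scale free.span_base) (auto simp: free_space_def)
    ultimately show "f \<in> free.span ((\<lambda>b. Poly_Mapping.single b (1 :: 'k)) ` X)" by metis
  qed
  have "free.subspace (free_space X :: ('b \<Rightarrow>\<^sub>0 'k) set)"
    unfolding free.subspace_def
  proof (intro conjI ballI allI)
    show "f + g \<in> free_space X" if "f \<in> free_space X" "g \<in> free_space X" for f g :: "'b \<Rightarrow>\<^sub>0 'k"
      using that keys_add[of f g] by (auto simp: free_space_def)
  qed (auto simp: free_space_def in_keys_iff subset_iff)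
  then show "free.span ((\<lambda>b. Poly_Mapping.single b (1 :: 'k)) ` X) \<subseteq> free_space X"
    by (intro free.span_minimal) (auto simp: free_space_def)
qed

context k_algebra
begin

interpretation free_mult: Vector_Spaces.linear free_scale scale free_mult
  by (rule free_mult_linear)

lemma subspace_tensor_relations: "free.subspace (tensor_relations A M N)"
  unfolding tensor_relations_def by (rule free.subspace_span)

lemma
  shows tensor_relations_add_left: "m \<in> M \<Longrightarrow> m' \<in> M \<Longrightarrow> n \<in> N \<Longrightarrow>
      free_gen (m + m') n - free_gen m n - free_gen m' n \<in> tensor_relations A M N"
    and tensor_relations_add_right: "m \<in> M \<Longrightarrow> n \<in> N \<Longrightarrow> n' \<in> N \<Longrightarrow>
      free_gen m (n + n') - free_gen m n - free_gen m n' \<in> tensor_relations A M N"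
    and tensor_relations_scale_left: "m \<in> M \<Longrightarrow> n \<in> N \<Longrightarrow>
      free_gen (c *s m) n - free_scale c (free_gen m n) \<in> tensor_relations A M N"
    and tensor_relations_scale_right: "m \<in> M \<Longrightarrow> n \<in> N \<Longrightarrow>
      free_gen m (c *s n) - free_scale c (free_gen m n) \<in> tensor_relations A M N"
    and tensor_relations_balanced: "m \<in> M \<Longrightarrow> a \<in> A \<Longrightarrow> n \<in> N \<Longrightarrow>
      free_gen (m * a) n - free_gen m (a * n) \<in> tensor_relations A M N"
  unfolding tensor_relations_def by (rule free.span_base; blast)+

text \<open>Distributivity, compatibility with scalars and associativity kill the five kinds of
  generators; thus multiplication descends to the tensor product.\<close>

lemma free_mult_tensor_relations:
  assumes "r \<in> tensor_relations A M N"
  shows "free_mult r = 0"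
proof -
  have "free.subspace {r. free_mult r = 0}"
    by (auto simp: free.subspace_def free_mult.add free_mult.scale free_mult.zero)
  then have "tensor_relations A M N \<subseteq> {r. free_mult r = 0}"
    unfolding tensor_relations_def
    by (intro free.span_minimal)
      (auto simp: free_mult.diff free_mult.scale distrib_left distrib_right mult.assoc
        mult_scale_left mult_scale_right)
  then show ?thesis using assms by blast
qed

lemma coset_tensor_relations_eq_iff:
  "f +o tensor_relations A M N = g +o tensor_relations A M N \<longleftrightarrow> f - g \<in> tensor_relations A M N"
  using free.subspace_0 free.subspace_diff subspace_tensor_relations
  by (intro elt_set_plus_eq_iff) blast+

text \<open>\<open>\<sigma>\<close> selects a normal form for each product. By linearity,
  \<open>rel\<close> makes every formal sum congruent to the normal form of its product, which gives
  injectivity; \<open>right_inverse\<close> gives surjectivity.\<close>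

lemma mult_induces_isoI:
  assumes lin: "Vector_Spaces.linear scale free_scale \<sigma>"
    and in_free: "\<And>a. \<sigma> a \<in> free_space (M \<times> N)" and right_inverse: "\<And>a. free_mult (\<sigma> a) = a"
    and rel: "\<And>m n. m \<in> M \<Longrightarrow> n \<in> N \<Longrightarrow> free_gen m n - \<sigma> (m * n) \<in> tensor_relations A M N"
  shows "mult_induces_iso A M N"
proof -
  let ?T = "tensor_relations A M N" and ?F = "free_space (M \<times> N) :: ('a \<times> 'a \<Rightarrow>\<^sub>0 'k) set"
  interpret \<sigma>: Vector_Spaces.linear scale free_scale \<sigma> by (rule lin)
  note T = subspace_tensor_relations[of A M N]
  have normal: "f - \<sigma> (free_mult f) \<in> ?T" if "f \<in> ?F" for f
    using that unfolding free_space_eq_span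
  proof (induction rule: free.span_induct)
    case base
    show ?case
      unfolding free.subspace_def mem_Collect_eq
    proof (intro conjI ballI allI)
      show "0 - \<sigma> (free_mult 0) \<in> ?T"
        using free.subspace_0[OF T] by (simp add: free_mult.zero \<sigma>.zero)
      show "f + g - \<sigma> (free_mult (f + g)) \<in> ?T"
        if "f \<in> {f. f - \<sigma> (free_mult f) \<in> ?T}" "g \<in> {f. f - \<sigma> (free_mult f) \<in> ?T}" for f g
        using free.subspace_add[OF T] that
        by (fastforce simp: free_mult.add \<sigma>.add algebra_simps)
      show "free_scale c f - \<sigma> (free_mult (free_scale c f)) \<in> ?T"
        if "f \<in> {f. f - \<sigma> (free_mult f) \<in> ?T}" for f c
        using free.subspace_scale[OF T, of "f - \<sigma> (free_mult f)" c] that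
        by (simp add: free_mult.scale \<sigma>.scale free.scale_right_diff_distrib)
    qed
  next
    case (step f)
    then show ?case using rel by auto
  qed
  \<comment> \<open>Any representative of the coset will do, since \<open>free_mult\<close> vanishes
    on the relations.\<close>
  define h where "h C = free_mult (SOME f. f \<in> ?F \<and> C = f +o ?T)" for C
  have h: "h (f +o ?T) = free_mult f" if f: "f \<in> ?F" for f
  proof -
    let ?g = "SOME g. g \<in> ?F \<and> f +o ?T = g +o ?T"
    have "f +o ?T = ?g +o ?T" using f by (metis (mono_tags, lifting) someI)
    then have "free_mult (f - ?g) = 0"
      by (intro free_mult_tensor_relations) (simp add: coset_tensor_relations_eq_iff)
    then show ?thesis by (simp add: h_def free_mult.diff)
  qed
  have "inj_on h (tensor_product A M N)"
  proof (rule inj_onI)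
    fix C D assume "C \<in> tensor_product A M N" "D \<in> tensor_product A M N" and eq: "h C = h D"
    then obtain f g where fg: "f \<in> ?F" "C = f +o ?T" "g \<in> ?F" "D = g +o ?T"
      by (auto simp: tensor_product_def)
    then have "free_mult f = free_mult g" using eq by (simp add: h)
    then have "f - g = (f - \<sigma> (free_mult f)) - (g - \<sigma> (free_mult g))" by simp
    also have "\<dots> \<in> ?T" by (intro free.subspace_diff[OF T] normal fg)
    finally show "C = D" unfolding fg coset_tensor_relations_eq_iff .
  qed
  moreover have "h ` tensor_product A M N = UNIV"
  proof (rule UNIV_eq_I[symmetric])
    fix a
    have "a = h (\<sigma> a +o ?T)" using in_free right_inverse by (simp add: h)
    then show "a \<in> h ` tensor_product A M N" using in_free by (auto simp: tensor_product_def)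
  qed
  ultimately show ?thesis
    unfolding mult_induces_iso_def using h by (auto simp: bij_betw_def)
qed

text \<open>Modulo the relations, \<open>free_gen m n - \<sigma> (m * n)\<close> is bilinear in
  \<open>m\<close> and \<open>n\<close>, so it suffices to test spanning sets.\<close>

lemma free_gen_cong_tensor_relations:
  assumes lin: "Vector_Spaces.linear scale free_scale \<sigma>"
    and gen: "\<And>x y. x \<in> X \<Longrightarrow> y \<in> Y \<Longrightarrow>
      free_gen x y - \<sigma> (x * y) \<in> tensor_relations A (span X) (span Y)"
    and "m \<in> span X" "n \<in> span Y"
  shows "free_gen m n - \<sigma> (m * n) \<in> tensor_relations A (span X) (span Y)" (is "_ \<in> ?T")
proof -
  interpret \<sigma>: Vector_Spaces.linear scale free_scale \<sigma> by (rule lin)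
  note T = subspace_tensor_relations[of A "span X" "span Y"]
  note T_add = free.subspace_add[OF T] and T_scale = free.subspace_scale[OF T]
  have left: "subspace {m \<in> span X. free_gen m n - \<sigma> (m * n) \<in> ?T}" if n: "n \<in> span Y" for n
    unfolding subspace_def
  proof (intro conjI ballI allI)
    show "0 \<in> {m \<in> span X. free_gen m n - \<sigma> (m * n) \<in> ?T}"
      \<comment> \<open>Scaling by \<open>0\<close> shows that \<open>free_gen 0 n\<close> is itself
        a relation.\<close>
      using tensor_relations_scale_left[OF span_zero n, of 0 A] by (simp add: \<sigma>.zero span_zero)
    fix m m' c assume m: "m \<in> {m \<in> span X. free_gen m n - \<sigma> (m * n) \<in> ?T}"
    have "free_gen (c *s m) n - \<sigma> (c *s m * n) =
        (free_gen (c *s m) n - free_scale c (free_gen m n)) +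
        free_scale c (free_gen m n - \<sigma> (m * n))"
      by (simp add: mult_scale_left \<sigma>.scale free.scale_right_diff_distrib)
    also have "\<dots> \<in> ?T"
      using m n by (intro T_add T_scale tensor_relations_scale_left) auto
    finally show "c *s m \<in> {m \<in> span X. free_gen m n - \<sigma> (m * n) \<in> ?T}"
      using m by (simp add: span_scale)
    assume m': "m' \<in> {m \<in> span X. free_gen m n - \<sigma> (m * n) \<in> ?T}"
    have "free_gen (m + m') n - \<sigma> ((m + m') * n) =
        (free_gen (m + m') n - free_gen m n - free_gen m' n) +
        ((free_gen m n - \<sigma> (m * n)) + (free_gen m' n - \<sigma> (m' * n)))"
      by (simp add: distrib_right \<sigma>.add)
    also have "\<dots> \<in> ?T"
      using m m' n by (intro T_add tensor_relations_add_left) auto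
    finally show "m + m' \<in> {m \<in> span X. free_gen m n - \<sigma> (m * n) \<in> ?T}"
      using m m' by (simp add: span_add)
  qed
  have right: "subspace {n \<in> span Y. free_gen m n - \<sigma> (m * n) \<in> ?T}" if m: "m \<in> span X" for m
    unfolding subspace_def
  proof (intro conjI ballI allI)
    show "0 \<in> {n \<in> span Y. free_gen m n - \<sigma> (m * n) \<in> ?T}"
      using tensor_relations_scale_right[OF m span_zero, of 0 A] by (simp add: \<sigma>.zero span_zero)
    fix n n' c assume n: "n \<in> {n \<in> span Y. free_gen m n - \<sigma> (m * n) \<in> ?T}"
    have "free_gen m (c *s n) - \<sigma> (m * c *s n) =
        (free_gen m (c *s n) - free_scale c (free_gen m n)) +
        free_scale c (free_gen m n - \<sigma> (m * n))"
      by (simp add: mult_scale_right \<sigma>.scale free.scale_right_diff_distrib)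
    also have "\<dots> \<in> ?T"
      using m n by (intro T_add T_scale tensor_relations_scale_right) auto
    finally show "c *s n \<in> {n \<in> span Y. free_gen m n - \<sigma> (m * n) \<in> ?T}"
      using n by (simp add: span_scale)
    assume n': "n' \<in> {n \<in> span Y. free_gen m n - \<sigma> (m * n) \<in> ?T}"
    have "free_gen m (n + n') - \<sigma> (m * (n + n')) =
        (free_gen m (n + n') - free_gen m n - free_gen m n') +
        ((free_gen m n - \<sigma> (m * n)) + (free_gen m n' - \<sigma> (m * n')))"
      by (simp add: distrib_left \<sigma>.add)
    also have "\<dots> \<in> ?T"
      using m n n' by (intro T_add tensor_relations_add_right) auto
    finally show "n + n' \<in> {n \<in> span Y. free_gen m n - \<sigma> (m * n) \<in> ?T}"
      using n n' by (simp add: span_add)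
  qed
  have "free_gen x n - \<sigma> (x * n) \<in> ?T" if "x \<in> X" for x
    using span_minimal[OF _ right[OF span_base[OF that]], of Y] gen[OF that] assms(4)
    by (auto intro: span_base)
  then show ?thesis
    using span_minimal[OF _ left[OF assms(4)], of X] assms(3) by (auto intro: span_base)
qed

end

section \<open>A basis of \<open>\<Lambda>\<^sub>P\<close>\<close>

interpretation Lambda_P: k_algebra
  "scale_Lambda_P :: 'k::field \<Rightarrow> ('k, 'p::{finite,order}) Lambda_P \<Rightarrow> ('k, 'p) Lambda_P"
  by unfold_locales
    (auto intro!: entry_eqI simp: algebra_simps entry_mult sum_distrib_left)

abbreviation quot_op :: "'p::{finite,order} set \<Rightarrow> 'p set \<Rightarrow> ('k::field, 'p) Lambda_P" where
  "quot_op R U \<equiv> op_mor R U (quot_map R U)"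

abbreviation incl_op :: "'p::{finite,order} set \<Rightarrow> 'p set \<Rightarrow> ('k::field, 'p) Lambda_P" where
  "incl_op U S \<equiv> op_mor U S (incl_map U S)"

lemma entry_quot_op:
  assumes "R \<in> intervals" "U \<in> downset_intervals R"
  shows "entry (quot_op R U) A B x = of_bool (A = R \<and> B = U \<and> x \<in> U)"
proof -
  have U: "U \<in> intervals" "U \<subseteq> R"
    using assms(2) relative_downset_subset[of U R] by (auto simp: downset_intervals_def)
  then show ?thesis
    unfolding entry_op_mor[OF assms(1) U(1) quot_map_Hom_P[OF assms(2)]]
    by (auto simp: quot_map_def)
qed

lemma entry_incl_op:
  assumes "S \<in> intervals" "U \<in> upset_intervals S"
  shows "entry (incl_op U S) A B x = of_bool (A = U \<and> B = S \<and> x \<in> U)"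
proof -
  have U: "U \<in> intervals" using assms(2) by (simp add: upset_intervals_def)
  then show ?thesis
    unfolding entry_op_mor[OF U assms(1) incl_map_Hom_P[OF assms(2)]]
    by (auto simp: incl_map_def)
qed

lemma entry_e_idem:
  fixes S :: "'p::{finite,order} set"
  assumes "S \<in> intervals"
  shows "entry (e_idem S :: ('k::field, 'p) Lambda_P) A B x = of_bool (A = S \<and> B = S \<and> x \<in> S)"
  unfolding e_idem_def
    entry_op_mor[OF assms assms Hom_P_id[OF poset_rep_interval_rep[OF assms, where 'k='k]]]
  by (auto simp: id_P_def interval_rep_def)

lemma e_idem_eq_quot_op: "S \<in> intervals \<Longrightarrow> e_idem S = quot_op S S"
  by (rule entry_eqI) (simp add: entry_e_idem entry_quot_op interval_in_downset_intervals)

lemma e_idem_eq_incl_op: "S \<in> intervals \<Longrightarrow> e_idem S = incl_op S S"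
  by (rule entry_eqI) (simp add: entry_e_idem entry_incl_op interval_in_upset_intervals)

section \<open>Products with the generators\<close>

lemma entry_quot_op_mult:
  assumes "R \<in> intervals" "U \<in> downset_intervals R"
  shows "entry (quot_op R U * a) A B x = of_bool (A = R \<and> x \<in> U) * entry a U B x"
proof -
  have "entry (quot_op R U * a) A B x =
      (\<Sum>T\<in>UNIV. if T = U then of_bool (A = R \<and> x \<in> U) * entry a U B x else 0)"
    unfolding entry_mult by (rule sum.cong) (auto simp: entry_quot_op[OF assms])
  then show ?thesis by simp
qed

lemma entry_mult_e_idem:
  assumes "S \<in> intervals"
  shows "entry (a * e_idem S) A B x = of_bool (B = S) * entry a A S x"
proof -
  have "entry (a * e_idem S) A B x =
      (\<Sum>T\<in>UNIV. if T = S then of_bool (B = S \<and> x \<in> S) * entry a A S x else 0)"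
    unfolding entry_mult by (rule sum.cong) (auto simp: entry_e_idem[OF assms])
  then show ?thesis using entry_nonzeroD(4)[of a A S x] by auto
qed

lemma entry_e_idem_mult:
  assumes "S \<in> intervals"
  shows "entry (e_idem S * a) A B x = of_bool (A = S) * entry a S B x"
  using entry_nonzeroD(3)[of a S B x]
  by (auto simp: e_idem_eq_quot_op[OF assms] interval_in_downset_intervals
      entry_quot_op_mult[OF assms] assms)

lemma entry_sandwich:
  assumes "S \<in> intervals" "T \<in> intervals"
  shows "entry (e_idem S * a * e_idem T) A B x = of_bool (A = S \<and> B = T) * entry a S T x"
  by (auto simp: entry_mult_e_idem[OF assms(2)] entry_e_idem_mult[OF assms(1)])

lemma entry_quot_op_mult_incl_op:
  assumes "R \<in> intervals" "U \<in> downset_intervals R" "S \<in> intervals" "V \<in> upset_intervals S"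
  shows "entry (quot_op R U * incl_op V S) A B x = of_bool (A = R \<and> B = S \<and> U = V \<and> x \<in> U)"
  by (auto simp: entry_quot_op_mult[OF assms(1,2)] entry_incl_op[OF assms(3,4)])

text \<open>Entries are constant on a suitable interval, so one chosen point suffices to read off
  the scalar.\<close>

definition base_point :: "'p set \<Rightarrow> 'p" where
  "base_point S = (SOME x. x \<in> S)"

lemma base_point_in: "S \<in> intervals \<Longrightarrow> base_point S \<in> S"
  by (auto simp: base_point_def intervals_def some_in_eq)

text \<open>A triple \<open>(R, U, S)\<close> stands for the composite of the projection from \<open>R\<close> to \<open>U\<close> and the
  inclusion of \<open>U\<close> into \<open>S\<close>.\<close>

definition factorizations :: "('p::order set \<times> 'p set \<times> 'p set) set" where
  "factorizations = {(R, U, S). R \<in> intervals \<and> S \<in> intervals \<and>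
     U \<in> downset_intervals R \<and> U \<in> upset_intervals S}"

lemma finite_factorizations [simp]:
  "finite (factorizations :: ('p::{finite,order} set \<times> 'p set \<times> 'p set) set)"
  by (rule finite_subset[OF subset_UNIV]) simp

definition coordinate ::
  "('k::field, 'p::{finite,order}) Lambda_P \<Rightarrow> 'p set \<times> 'p set \<times> 'p set \<Rightarrow> 'k" where
  "coordinate a = (\<lambda>(R, U, S). entry a R S (base_point U))"

lemma entry_factorization:
  assumes "(R, U, S) \<in> factorizations" "x \<in> U"
  shows "entry a R S x = coordinate a (R, U, S)"
proof -
  have U: "poset_connected U" "U \<subseteq> R" "U \<subseteq> S" "base_point U \<in> U"
    using assms(1) base_point_in[of U]
    by (auto simp: factorizations_def downset_intervals_def upset_intervals_def intervals_def
        dest!: relative_downset_subset relative_upset_subset)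
  show ?thesis
    unfolding coordinate_def using entry_constant[OF U(1-3) assms(2) U(4)] by simp
qed

text \<open>The middle interval is the component of \<open>x\<close> in the support of the
  entry.\<close>

lemma entry_nonzero_factorization:
  assumes "entry a R S x \<noteq> 0"
  obtains U where "(R, U, S) \<in> factorizations" "x \<in> U"
proof -
  note D = entry_nonzeroD[OF assms]
  obtain U where "U \<in> downset_intervals R" "U \<in> upset_intervals S" "x \<in> U"
    using clopen_component[OF _ relative_downset_entry relative_upset_entry, of R x a S] assms D(1)
    by (auto simp: intervals_def)
  then show ?thesis using that D by (auto simp: factorizations_def)
qed

text \<open>At \<open>A\<close>, \<open>B\<close>, \<open>x\<close> only a triple
  \<open>(A, U, B)\<close> with \<open>x \<in> U\<close> contributes. Disjointness makes it unique,
  and its coordinate is the entry; if there is none, the entry vanishes.\<close>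

lemma Lambda_P_expansion:
  "a = (\<Sum>(R, U, S)\<in>factorizations. scale_Lambda_P (coordinate a (R, U, S)) (quot_op R U * incl_op U S))"
proof (rule entry_eqI)
  fix A B x
  let ?t = "\<lambda>p. case p of (R, U, S) \<Rightarrow>
    coordinate a (R, U, S) * of_bool (A = R \<and> B = S \<and> x \<in> U)"
  have "entry (\<Sum>(R, U, S)\<in>factorizations. scale_Lambda_P (coordinate a (R, U, S))
      (quot_op R U * incl_op U S)) A B x = (\<Sum>p\<in>factorizations. ?t p)"
    unfolding entry_sum
    by (rule sum.cong) (auto simp: factorizations_def entry_quot_op_mult_incl_op)
  also have "\<dots> = entry a A B x"
  proof (cases "\<exists>U. (A, U, B) \<in> factorizations \<and> x \<in> U")
    case True
    then obtain U where U: "(A, U, B) \<in> factorizations" "x \<in> U" by blast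
    have "(\<Sum>p\<in>factorizations. ?t p) = (\<Sum>p\<in>factorizations. if p = (A, U, B) then entry a A B x else 0)"
    proof (rule sum.cong[OF refl])
      fix p :: "'b set \<times> 'b set \<times> 'b set" assume p: "p \<in> factorizations"
      show "?t p = (if p = (A, U, B) then entry a A B x else 0)"
      proof (cases p)
        case (fields R V S)
        have V: "V = U" if "R = A" "S = B" "x \<in> V"
          using downset_upset_intervals_disjoint[of V A B U x] that p U
          unfolding fields factorizations_def by blast
        show ?thesis
        proof (cases "R = A \<and> S = B \<and> x \<in> V")
          case True
          with V have "p = (A, U, B)" using fields by blast
          then show ?thesis using U(2) by (simp add: entry_factorization[OF U])
        qed (use fields U(2) in auto)
      qed
    qed
    then show ?thesis using U(1) by simp
  next
    case False
    then have "entry a A B x = 0" using entry_nonzero_factorization[of a A B x] by blast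
    moreover have "(\<Sum>p\<in>factorizations. ?t p) = 0"
      using False by (intro sum.neutral) auto
    ultimately show ?thesis by simp
  qed
  finally show "entry a A B x = entry (\<Sum>(R, U, S)\<in>factorizations.
      scale_Lambda_P (coordinate a (R, U, S)) (quot_op R U * incl_op U S)) A B x" ..
qed

section \<open>Elementarity\<close>

definition diag :: "'p set \<Rightarrow> ('k::field, 'p::{finite,order}) Lambda_P \<Rightarrow> 'k" where
  "diag S a = entry a S S (base_point S)"

text \<open>An endomorphism of an interval representation is a scalar, because the interval is
  connected.\<close>

lemma entry_diag:
  assumes "S \<in> intervals" "x \<in> S"
  shows "entry a S S x = diag S a"
  unfolding diag_def
  by (rule entry_constant[of S]) (use assms base_point_in in \<open>auto simp: intervals_def\<close>)

lemma diag_add [simp]: "diag S (a + b) = diag S a + diag S b"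
  by (simp add: diag_def)

lemma diag_scale [simp]: "diag S (scale_Lambda_P c a) = c * diag S a"
  by (simp add: diag_def)

lemma diag_one: "S \<in> intervals \<Longrightarrow> diag S 1 = 1"
  by (simp add: diag_def entry_one base_point_in)

lemma diag_e_idem: "S \<in> intervals \<Longrightarrow> T \<in> intervals \<Longrightarrow> diag S (e_idem T) = of_bool (S = T)"
  using base_point_in[of T] by (auto simp: diag_def entry_e_idem)

text \<open>A nonzero summand through \<open>T\<close> would place \<open>T\<close> both above and
  below \<open>S\<close> in the order at the base point, so only \<open>T = S\<close>
  remains.\<close>

lemma diag_mult:
  assumes "S \<in> intervals"
  shows "diag S (a * b) = diag S a * diag S b"
proof -
  let ?x = "base_point S"
  have "entry a S T ?x * entry b T S ?x = (if T = S then diag S a * diag S b else 0)" for T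
    using interval_le_antisym[OF entry_interval_le[of a S T ?x] entry_interval_le[of b T S ?x]]
    by (auto simp: diag_def)
  then show ?thesis by (simp add: diag_def[of S "a * b"] entry_mult)
qed

lemma sandwich_eq_scale:
  assumes "S \<in> intervals"
  shows "e_idem S * a * e_idem S = scale_Lambda_P (diag S a) (e_idem S)"
  using entry_nonzeroD(3)[of a S S] entry_diag[OF assms, of _ a]
  by (intro entry_eqI) (auto simp: entry_sandwich assms entry_e_idem)

lemma e_idem_mult_self: "S \<in> intervals \<Longrightarrow> e_idem S * e_idem S = e_idem S"
  by (rule entry_eqI) (auto simp: entry_e_idem_mult entry_e_idem)

text \<open>Orthogonality puts \<open>f\<close> into the corner cut out by \<open>e_idem S\<close>,
  which consists of scalar multiples of \<open>e_idem S\<close>; the scalar of \<open>f\<close> is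
  idempotent in a field, hence \<open>0\<close> or \<open>1\<close>.\<close>

lemma primitive_idempotent_e_idem:
  assumes S: "S \<in> intervals"
  shows "primitive_idempotent (e_idem S :: ('k::field, 'p::{finite,order}) Lambda_P)"
  unfolding primitive_idempotent_def
proof (intro conjI allI impI)
  show "e_idem S * e_idem S = e_idem S" using S by (rule e_idem_mult_self)
  have "diag S (e_idem S :: ('k, 'p) Lambda_P) = 1" using S by (simp add: diag_e_idem)
  then show "e_idem S \<noteq> (0 :: ('k, 'p) Lambda_P)" by (auto simp: diag_def)
  fix f g :: "('k, 'p) Lambda_P" assume f: "f * f = f" and "g * g = g" "f * g = 0" "g * f = 0"
    and e: "e_idem S = f + g"
  then have "e_idem S * f = f" "f * e_idem S = f" by (simp_all add: distrib_left distrib_right)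
  then have fe: "f = scale_Lambda_P (diag S f) (e_idem S)"
    using sandwich_eq_scale[OF S, of f] by simp
  have "diag S f * diag S f = diag S f" using diag_mult[OF S, of f f] f by simp
  then consider "diag S f = 0" | "diag S f = 1" by auto
  then show "f = 0 \<or> g = 0"
  proof cases
    case 1
    then show ?thesis using fe by simp
  next
    case 2
    then show ?thesis using fe e by simp
  qed
qed

lemma complete_primitive_orthogonal_idempotents_e_idem:
  "complete_primitive_orthogonal_idempotents intervals
    (e_idem :: 'p::{finite,order} set \<Rightarrow> ('k::field, 'p) Lambda_P)"
  unfolding complete_primitive_orthogonal_idempotents_def
proof (intro conjI ballI impI)
  show "e_idem S * e_idem T = (0 :: ('k, 'p) Lambda_P)"
    if "S \<in> intervals" "T \<in> intervals" "S \<noteq> T" for S T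
    using that by (intro entry_eqI) (auto simp: entry_e_idem_mult entry_e_idem)
  show "(\<Sum>S\<in>intervals. e_idem S) = (1 :: ('k, 'p) Lambda_P)"
  proof (rule entry_eqI)
    fix A B :: "'p set" and x
    have "entry (\<Sum>S\<in>intervals. e_idem S :: ('k, 'p) Lambda_P) A B x =
        (\<Sum>S\<in>intervals. if S = A then of_bool (B = A \<and> x \<in> A) else 0)"
      unfolding entry_sum by (rule sum.cong) (auto simp: entry_e_idem)
    then show "entry (\<Sum>S\<in>intervals. e_idem S) A B x = entry (1 :: ('k, 'p) Lambda_P) A B x"
      by (simp add: entry_one) (auto simp: of_bool_def)
  qed
qed (auto intro: primitive_idempotent_e_idem)

text \<open>With vanishing diagonal scalars every factor moves to a strictly larger interval in the
  order at \<open>x\<close>, raising the rank by at least one.\<close>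

lemma entry_power_rank:
  assumes "\<And>S. S \<in> intervals \<Longrightarrow> diag S a = 0" "entry (a ^ n) R S x \<noteq> 0"
  shows "n \<le> interval_rank x S"
  using assms(2)
proof (induction n arbitrary: S)
  case (Suc n)
  then obtain T where "entry (a ^ n) R T x * entry a T S x \<noteq> 0"
    unfolding power_Suc2 entry_mult by (meson sum.neutral)
  then have T: "entry (a ^ n) R T x \<noteq> 0" "entry a T S x \<noteq> 0" by auto
  have "T \<noteq> S"
    using T(2) entry_nonzeroD[OF T(2)] entry_diag[of S x a] assms(1) by auto
  then have "interval_rank x T < interval_rank x S"
    using entry_interval_le[OF T(2)] by (rule interval_rank_less[rotated])
  then show ?case using Suc.IH[OF T(1)] by simp
qed simp

text \<open>Each \<open>diag S\<close> is a character, so its kernel is a maximal left ideal;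
  conversely, the common kernel is a nil left ideal.\<close>

lemma jacobson_radical_Lambda_P:
  "(jacobson_radical :: ('k::field, 'p::{finite,order}) Lambda_P set) =
    {a. \<forall>S\<in>intervals. diag S a = 0}" (is "_ = ?N")
proof
  have "maximal_left_ideal {a :: ('k, 'p) Lambda_P. diag S a = 0}" if "S \<in> intervals" for S
    by (rule Lambda_P.maximal_left_ideal_character_kernel)
      (use that in \<open>simp_all add: diag_mult diag_one\<close>)
  then show "jacobson_radical \<subseteq> ?N"
    unfolding jacobson_radical_def by blast
  show "?N \<subseteq> jacobson_radical"
  proof (rule nil_left_ideal_subset_jacobson_radical)
    show "left_ideal ?N" by (auto simp: left_ideal_def diag_mult) (simp add: diag_def)
    fix a assume a: "a \<in> ?N"
    \<comment> \<open>A rank is at most the number of subsets, so this exponent exceeds every rank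
      at every point.\<close>
    let ?n = "Suc (card (UNIV :: 'p set set))"
    have "interval_rank x S < ?n" for x :: 'p and S
      unfolding interval_rank_def less_Suc_eq_le by (rule card_mono) auto
    then have "entry (a ^ ?n) R S x = 0" for R S x
      using entry_power_rank[of a ?n R S x] a by (metis (mono_tags) mem_Collect_eq not_less)
    then have "a ^ ?n = 0" by (intro entry_eqI) simp
    then show "\<exists>n. a ^ n = 0" by blast
  qed
qed

text \<open>The diagonal scalars identify the quotient by the radical with a product of copies of
  the field, one for each interval; combinations of the idempotents realise every tuple.\<close>

lemma elementary_algebra_Lambda_P:
  "elementary_algebra (scale_Lambda_P :: 'k::field \<Rightarrow> ('k, 'p::{finite,order}) Lambda_P \<Rightarrow> _)"
proof
  let ?B = "(\<lambda>(R, U, S). quot_op R U * incl_op U S) ` factorizations :: ('k, 'p) Lambda_P set"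
  have "a \<in> Lambda_P.span ?B" for a
    by (subst Lambda_P_expansion, rule Lambda_P.span_sum)
      (force intro!: Lambda_P.span_scale intro: Lambda_P.span_base)
  then show "\<exists>B :: ('k, 'p) Lambda_P set. finite B \<and> Lambda_P.span B = UNIV"
    by (intro exI[of _ ?B]) auto
  let ?J = "jacobson_radical :: ('k, 'p) Lambda_P set"
  define n where "n = card (intervals :: 'p set set)"
  obtain E where E: "bij_betw E {0..<n} (intervals :: 'p set set)"
    unfolding n_def using ex_bij_betw_nat_finite[of "intervals :: 'p set set"] by auto
  have E_in: "E i \<in> intervals" if "i < n" for i
    using E that by (auto simp: bij_betw_def)
  have coset: "a +o ?J = b +o ?J \<longleftrightarrow> (\<forall>i<n. diag (E i) a = diag (E i) b)" for a b
  proof -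
    have "a +o ?J = b +o ?J \<longleftrightarrow> a - b \<in> ?J"
      by (rule elt_set_plus_eq_iff) (auto simp: jacobson_radical_Lambda_P diag_def)
    also have "\<dots> \<longleftrightarrow> (\<forall>S\<in>E ` {0..<n}. diag S a = diag S b)"
      using E by (simp add: jacobson_radical_Lambda_P bij_betw_def diag_def)
    finally show ?thesis by auto
  qed
  \<comment> \<open>By \<open>coset\<close> the chosen representative does not matter; the value
    \<open>0\<close> from \<open>n\<close> on matches the encoding of the product.\<close>
  define h :: "('k, 'p) Lambda_P set \<Rightarrow> nat \<Rightarrow> 'k"
    where "h C = (\<lambda>i. if i < n then diag (E i) (SOME a. C = a +o ?J) else 0)" for C
  have h: "h (a +o ?J) = (\<lambda>i. if i < n then diag (E i) a else 0)" for a
  proof -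
    have "a +o ?J = (SOME b. a +o ?J = b +o ?J) +o ?J" by (rule someI[of _ a]) simp
    then show ?thesis unfolding h_def coset by auto
  qed
  have "bij_betw h (range (\<lambda>x. x +o ?J)) {v. \<forall>i\<ge>n. v i = 0}"
    unfolding bij_betw_def
  proof
    show "inj_on h (range (\<lambda>x. x +o ?J))"
    proof (rule inj_onI)
      fix C D assume "C \<in> range (\<lambda>x. x +o ?J)" "D \<in> range (\<lambda>x. x +o ?J)" and eq: "h C = h D"
      then obtain a b where ab: "C = a +o ?J" "D = b +o ?J" by blast
      show "C = D"
        unfolding ab coset
      proof (intro allI impI)
        show "diag (E i) a = diag (E i) b" if "i < n" for i
          using fun_cong[OF eq, of i] that by (simp add: ab h)
      qed
    qed
    have "v \<in> h ` range (\<lambda>x. x +o ?J)" if v: "\<forall>i\<ge>n. v i = 0" for v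
    proof -
      let ?a = "\<Sum>j<n. scale_Lambda_P (v j) (e_idem (E j))"
      have "diag (E i) ?a = v i" if "i < n" for i
      proof -
        have "diag (E i) ?a = (\<Sum>j<n. v j * diag (E i) (e_idem (E j) :: ('k, 'p) Lambda_P))"
          by (simp add: diag_def entry_sum)
        also have "\<dots> = (\<Sum>j<n. if j = i then v i else 0)"
          using E that E_in
          by (intro sum.cong) (auto simp: diag_e_idem bij_betw_def inj_on_eq_iff)
        finally show ?thesis using that by simp
      qed
      then have "v = h (?a +o ?J)" using v by (auto simp: h fun_eq_iff)
      then show ?thesis by blast
    qed
    then show "h ` range (\<lambda>x. x +o ?J) = {v. \<forall>i\<ge>n. v i = 0}" by (auto simp: h)
  qed
  then show "\<exists>n. \<exists>h :: ('k, 'p) Lambda_P set \<Rightarrow> nat \<Rightarrow> 'k.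
      bij_betw h (range (\<lambda>x. x +o ?J)) {v. \<forall>i\<ge>n. v i = 0} \<and>
      (\<forall>i<n. h (1 +o ?J) i = 1) \<and>
      (\<forall>x y i. h ((x + y) +o ?J) i = h (x +o ?J) i + h (y +o ?J) i) \<and>
      (\<forall>x y i. h ((x * y) +o ?J) i = h (x +o ?J) i * h (y +o ?J) i) \<and>
      (\<forall>c x i. h (scale_Lambda_P c x +o ?J) i = c * h (x +o ?J) i)"
    by (intro exI[of _ n] exI[of _ h]) (simp add: h E_in diag_one diag_mult)
qed

section \<open>The subalgebras and their tensor product\<close>

lemma subspace_entry_support:
  "Lambda_P.subspace {a. \<forall>R S x. entry a R S x \<noteq> 0 \<longrightarrow> Q R S}" (is "Lambda_P.subspace ?A")
  unfolding Lambda_P.subspace_def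
proof (intro conjI ballI allI)
  fix a b assume ab: "a \<in> ?A" "b \<in> ?A"
  have "Q R S" if "entry (a + b) R S x \<noteq> 0" for R S x
  proof -
    have "entry a R S x \<noteq> 0 \<or> entry b R S x \<noteq> 0" using that by auto
    then show ?thesis using ab by blast
  qed
  then show "a + b \<in> ?A" by blast
qed auto

text \<open>For the converse, a nonzero coordinate forces \<open>S\<close> to be a relative downset
  of \<open>R\<close>. The middle interval \<open>U\<close> is then both a relative downset and
  upset in \<open>S\<close>, so \<open>U = S\<close> and the composite is a projection.\<close>

lemma Lambda_P_plus_iff:
  "a \<in> Lambda_P_plus \<longleftrightarrow> (\<forall>R S x. entry a R S x \<noteq> 0 \<longrightarrow> S \<in> downset_intervals R)"
  (is "_ \<longleftrightarrow> ?P a")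
proof
  have "Lambda_P_plus \<subseteq> {a. ?P a}"
    unfolding Lambda_P_plus_def
    by (intro Lambda_P.span_minimal subspace_entry_support) (auto simp: entry_quot_op)
  then show "a \<in> Lambda_P_plus \<Longrightarrow> ?P a" by blast
  assume a: "?P a"
  have "scale_Lambda_P (coordinate a (R, U, S)) (quot_op R U * incl_op U S) \<in> Lambda_P_plus"
    if F: "(R, U, S) \<in> factorizations" for R U S
  proof (cases "coordinate a (R, U, S) = 0")
    case True
    then show ?thesis by (simp add: Lambda_P_plus_def Lambda_P.span_zero)
  next
    case False
    then have S: "S \<in> downset_intervals R" using a by (auto simp: coordinate_def)
    have F': "R \<in> intervals" "S \<in> intervals" "U \<in> intervals"
      "relative_downset U R" "relative_upset U S" "relative_downset S R"
      using F S by (auto simp: factorizations_def downset_intervals_def upset_intervals_def)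
    have "relative_downset (U \<inter> S) S"
      using F'(2,4,5,6) unfolding relative_downset_def by blast
    moreover have "U \<inter> S = U" using relative_upset_subset[OF F'(5)] by blast
    ultimately have "U = S"
      using poset_connected_clopen[of S U] F'(2,3,5) by (auto simp: intervals_def)
    then have "quot_op R U * incl_op U S = (quot_op R S :: ('a, 'b) Lambda_P)"
      using F' S by (intro entry_eqI)
        (simp add: entry_quot_op_mult_incl_op entry_quot_op interval_in_upset_intervals)
    then show ?thesis
      using F' S unfolding Lambda_P_plus_def
      by (auto intro!: Lambda_P.span_scale intro: Lambda_P.span_base)
  qed
  then show "a \<in> Lambda_P_plus"
    unfolding Lambda_P_plus_def
    by (subst Lambda_P_expansion, intro Lambda_P.span_sum) auto
qed

text \<open>The mirror image: here the middle interval is forced to be \<open>R\<close>, leaving an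
  inclusion.\<close>

lemma Lambda_P_minus_iff:
  "a \<in> Lambda_P_minus \<longleftrightarrow> (\<forall>R S x. entry a R S x \<noteq> 0 \<longrightarrow> R \<in> upset_intervals S)"
  (is "_ \<longleftrightarrow> ?P a")
proof
  have "Lambda_P_minus \<subseteq> {a. ?P a}"
    unfolding Lambda_P_minus_def
    by (intro Lambda_P.span_minimal subspace_entry_support) (auto simp: entry_incl_op)
  then show "a \<in> Lambda_P_minus \<Longrightarrow> ?P a" by blast
  assume a: "?P a"
  have "scale_Lambda_P (coordinate a (R, U, S)) (quot_op R U * incl_op U S) \<in> Lambda_P_minus"
    if F: "(R, U, S) \<in> factorizations" for R U S
  proof (cases "coordinate a (R, U, S) = 0")
    case True
    then show ?thesis by (simp add: Lambda_P_minus_def Lambda_P.span_zero)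
  next
    case False
    then have R: "R \<in> upset_intervals S" using a by (auto simp: coordinate_def)
    have F': "R \<in> intervals" "S \<in> intervals" "U \<in> intervals"
      "relative_downset U R" "relative_upset U S" "relative_upset R S"
      using F R by (auto simp: factorizations_def downset_intervals_def upset_intervals_def)
    have "relative_upset (U \<inter> R) R"
      using F'(2,4,5,6) unfolding relative_upset_def by blast
    moreover have "U \<inter> R = U" using relative_downset_subset[OF F'(4)] by blast
    ultimately have "U = R"
      using poset_connected_clopen[of R U] F'(1,3,4) by (auto simp: intervals_def)
    then have "quot_op R U * incl_op U S = (incl_op R S :: ('a, 'b) Lambda_P)"
      using F' R by (intro entry_eqI)
        (auto simp: entry_quot_op_mult_incl_op entry_incl_op interval_in_downset_intervals)
    then show ?thesis
      using F' R unfolding Lambda_P_minus_def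
      by (auto intro!: Lambda_P.span_scale intro: Lambda_P.span_base)
  qed
  then show "a \<in> Lambda_P_minus"
    unfolding Lambda_P_minus_def
    by (subst Lambda_P_expansion, intro Lambda_P.span_sum) auto
qed

lemma entry_mult_nonzero:
  assumes "entry (a * b) R S x \<noteq> 0"
  obtains T where "entry a R T x \<noteq> 0" "entry b T S x \<noteq> 0"
proof -
  have "\<exists>T. entry a R T x * entry b T S x \<noteq> 0"
    using assms unfolding entry_mult by (meson sum.neutral)
  then show ?thesis using that by auto
qed

lemma unital_subalgebra_Lambda_P_plus: "Lambda_P.unital_subalgebra Lambda_P_plus"
  unfolding Lambda_P.unital_subalgebra_def
proof (intro conjI ballI)
  show "Lambda_P.subspace Lambda_P_plus"
    unfolding Lambda_P_plus_def by (rule Lambda_P.subspace_span)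
  show "1 \<in> Lambda_P_plus"
    by (auto simp: Lambda_P_plus_iff entry_one interval_in_downset_intervals)
  show "a * b \<in> Lambda_P_plus" if "a \<in> Lambda_P_plus" "b \<in> Lambda_P_plus" for a b
    using that unfolding Lambda_P_plus_iff by (metis entry_mult_nonzero downset_intervals_trans)
qed

lemma unital_subalgebra_Lambda_P_minus: "Lambda_P.unital_subalgebra Lambda_P_minus"
  unfolding Lambda_P.unital_subalgebra_def
proof (intro conjI ballI)
  show "Lambda_P.subspace Lambda_P_minus"
    unfolding Lambda_P_minus_def by (rule Lambda_P.subspace_span)
  show "1 \<in> Lambda_P_minus"
    by (auto simp: Lambda_P_minus_iff entry_one interval_in_upset_intervals)
  show "a * b \<in> Lambda_P_minus" if "a \<in> Lambda_P_minus" "b \<in> Lambda_P_minus" for a b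
    using that unfolding Lambda_P_minus_iff by (metis entry_mult_nonzero upset_intervals_trans)
qed

section \<open>Generators and corners of the two subalgebras\<close>

lemma quot_op_in_Lambda_P_plus:
  "R \<in> intervals \<Longrightarrow> U \<in> downset_intervals R \<Longrightarrow> quot_op R U \<in> Lambda_P_plus"
  by (simp add: Lambda_P_plus_iff entry_quot_op)

lemma incl_op_in_Lambda_P_minus:
  "S \<in> intervals \<Longrightarrow> U \<in> upset_intervals S \<Longrightarrow> incl_op U S \<in> Lambda_P_minus"
  by (simp add: Lambda_P_minus_iff entry_incl_op)

lemma e_idem_in_Lambda_P_plus: "S \<in> intervals \<Longrightarrow> e_idem S \<in> Lambda_P_plus"
  by (simp add: e_idem_eq_quot_op quot_op_in_Lambda_P_plus interval_in_downset_intervals)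

lemma e_idem_in_Lambda_P_minus: "S \<in> intervals \<Longrightarrow> e_idem S \<in> Lambda_P_minus"
  by (simp add: e_idem_eq_incl_op incl_op_in_Lambda_P_minus interval_in_upset_intervals)

lemma sandwich_set_eq:
  fixes A :: "('k::field, 'p::{finite,order}) Lambda_P set"
  assumes S: "S \<in> intervals" and A: "Lambda_P.subspace A" "e_idem S \<in> A"
  shows "{e_idem S * a * e_idem S | a. a \<in> A} = {scale_Lambda_P c (e_idem S) | c. True}"
proof (intro set_eqI iffI)
  fix b :: "('k, 'p) Lambda_P" assume "b \<in> {scale_Lambda_P c (e_idem S) | c. True}"
  then obtain c where b: "b = scale_Lambda_P c (e_idem S)" by blast
  have "b = e_idem S * b * e_idem S"
    using S by (simp add: b sandwich_eq_scale diag_e_idem)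
  moreover have "b \<in> A" unfolding b using A by (rule Lambda_P.subspace_scale)
  ultimately show "b \<in> {e_idem S * a * e_idem S | a. a \<in> A}" by blast
qed (auto simp: sandwich_eq_scale[OF S])

lemma sandwich_set_nonzero:
  fixes A :: "('k::field, 'p::{finite,order}) Lambda_P set"
  assumes "S \<in> intervals" "T \<in> intervals" "0 \<in> A"
    and "{e_idem S * a * e_idem T | a. a \<in> A} \<noteq> {0}"
  obtains a x where "a \<in> A" "entry a S T x \<noteq> 0"
proof -
  \<comment> \<open>Since \<open>0\<close> is in the set, differing from \<open>{0}\<close> yields a
    nonzero element.\<close>
  have "0 \<in> {e_idem S * a * e_idem T | a. a \<in> A}" using assms(3) by force
  then obtain a where a: "a \<in> A" "e_idem S * a * e_idem T \<noteq> 0" using assms(4) by blast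
  have "\<exists>x. entry a S T x \<noteq> 0"
  proof (rule ccontr)
    assume "\<not> ?thesis"
    then have "e_idem S * a * e_idem T = 0"
      by (intro entry_eqI) (simp add: entry_sandwich assms(1,2))
    then show False using a(2) by simp
  qed
  then show ?thesis using that a(1) by blast
qed

text \<open>The normal form \<open>\<sigma> a\<close> is the expansion of \<open>a\<close> with its
  products read as pure tensors; congruence is checked on pairs of a projection and an
  inclusion.\<close>

lemma mult_induces_iso_Lambda_P:
  "Lambda_P.mult_induces_iso (Lambda_P.span (e_idem ` intervals))
    (Lambda_P_plus :: ('k::field, 'p::{finite,order}) Lambda_P set) Lambda_P_minus"
proof (rule Lambda_P.mult_induces_isoI)
  define \<sigma> :: "('k, 'p) Lambda_P \<Rightarrow> ('k, 'p) Lambda_P \<times> ('k, 'p) Lambda_P \<Rightarrow>\<^sub>0 'k"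
    where "\<sigma> a = (\<Sum>(R, U, S)\<in>factorizations.
    free_scale (coordinate a (R, U, S)) (free_gen (quot_op R U) (incl_op U S)))" for a
  show lin: "Vector_Spaces.linear scale_Lambda_P free_scale \<sigma>"
    by unfold_locales
      (auto simp: \<sigma>_def coordinate_def case_prod_beta free.scale_left_distrib sum.distrib
        free.scale_sum_right)
  interpret \<sigma>: Vector_Spaces.linear scale_Lambda_P free_scale \<sigma> by (rule lin)
  interpret free_mult: Vector_Spaces.linear free_scale scale_Lambda_P
    "Lambda_P.free_mult :: _ \<Rightarrow> ('k, 'p) Lambda_P"
    by (rule Lambda_P.free_mult_linear)
  show "\<sigma> a \<in> free_space (Lambda_P_plus \<times> Lambda_P_minus)" for a
    unfolding free_space_eq_span \<sigma>_def
    by (rule free.span_sum)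
      (auto simp: factorizations_def quot_op_in_Lambda_P_plus incl_op_in_Lambda_P_minus
        intro!: free.span_scale intro: free.span_base)
  show "Lambda_P.free_mult (\<sigma> a) = a" for a
    by (subst (2) Lambda_P_expansion)
      (simp add: \<sigma>_def free_mult.sum free_mult.scale case_prod_beta)
  let ?T = "Lambda_P.tensor_relations (Lambda_P.span (e_idem ` intervals))
    (Lambda_P_plus :: ('k, 'p) Lambda_P set) Lambda_P_minus"
  note T = Lambda_P.subspace_tensor_relations
  show "free_gen m n - \<sigma> (m * n) \<in> ?T" if "m \<in> Lambda_P_plus" "n \<in> Lambda_P_minus" for m n
    using that unfolding Lambda_P_plus_def Lambda_P_minus_def
  proof (rule Lambda_P.free_gen_cong_tensor_relations[OF lin, rotated],
      fold Lambda_P_plus_def Lambda_P_minus_def)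
    fix q j :: "('k, 'p) Lambda_P"
    assume "q \<in> {quot_op R U | R U. R \<in> intervals \<and> U \<in> downset_intervals R}"
      and "j \<in> {incl_op V S | V S. S \<in> intervals \<and> V \<in> upset_intervals S}"
    then obtain R U V S where q: "q = quot_op R U" "R \<in> intervals" "U \<in> downset_intervals R"
      and j: "j = incl_op V S" "S \<in> intervals" "V \<in> upset_intervals S" by blast
    show "free_gen q j - \<sigma> (q * j) \<in> ?T"
    proof (cases "U = V")
      case True
      have F: "(R, U, S) \<in> factorizations" using q j True by (simp add: factorizations_def)
      \<comment> \<open>Disjointness of middle intervals shows that the expansion of
        \<open>q * j\<close> is the single triple \<open>(R, U, S)\<close>.\<close>
      have "coordinate (q * j) (A, B, C) = of_bool ((A, B, C) = (R, U, S))"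
        if "(A, B, C) \<in> factorizations" for A B C
      proof -
        have B: "B \<in> intervals" using that by (simp add: factorizations_def downset_intervals_def)
        have "coordinate (q * j) (A, B, C) = of_bool (A = R \<and> C = S \<and> base_point B \<in> U)"
          unfolding coordinate_def q(1) j(1) prod.case entry_quot_op_mult_incl_op[OF q(2,3) j(2,3)]
          using True by simp
        moreover have "B = U" if "A = R" "C = S" "base_point B \<in> U"
          using downset_upset_intervals_disjoint[of B R S U "base_point B"] base_point_in[OF B]
            that \<open>(A, B, C) \<in> factorizations\<close> F unfolding factorizations_def by blast
        ultimately show ?thesis using base_point_in[OF B] by auto
      qed
      then have "\<sigma> (q * j) = (\<Sum>p\<in>factorizations. if p = (R, U, S) then free_gen q j else 0)"
        unfolding \<sigma>_def using q(1) j(1) True by (intro sum.cong) auto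
      then show ?thesis using F free.subspace_0[OF T] by simp
    next
      case False
      have U: "U \<in> intervals" using q(3) by (simp add: downset_intervals_def)
      have qj: "q * j = 0"
        using q j False by (intro entry_eqI) (simp add: entry_quot_op_mult_incl_op)
      have qe: "q * e_idem U = q"
        using q U by (intro entry_eqI) (auto simp: entry_mult_e_idem entry_quot_op)
      have ej: "e_idem U * j = 0"
        using j U False by (intro entry_eqI) (auto simp: entry_e_idem_mult entry_incl_op)
      have mem: "q \<in> Lambda_P_plus" "j \<in> Lambda_P_minus" "0 \<in> (Lambda_P_minus :: ('k, 'p) Lambda_P set)"
        "e_idem U \<in> Lambda_P.span (e_idem ` intervals)"
        using q j U quot_op_in_Lambda_P_plus incl_op_in_Lambda_P_minus
        by (auto simp: Lambda_P_minus_iff[of 0] intro: Lambda_P.span_base)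
      \<comment> \<open>Write \<open>q\<close> as \<open>q * e_idem U\<close> and move the
        idempotent to the other factor, where it annihilates \<open>j\<close>.\<close>
      have "free_gen q j - free_gen q 0 \<in> ?T"
        using Lambda_P.tensor_relations_balanced[OF mem(1,4,2)] by (simp add: qe ej)
      moreover have "free_gen q 0 \<in> ?T"
        using Lambda_P.tensor_relations_scale_right[OF mem(1,3), of 0] by simp
      ultimately have "free_gen q j - free_gen q 0 + free_gen q 0 \<in> ?T"
        by (rule free.subspace_add[OF T])
      then show ?thesis by (simp add: qj \<sigma>.zero)
    qed
  qed
qed

theorem theorem1p1:
  assumes "poset_connected (UNIV :: 'p::{finite,order} set)"
  shows "reedy_algebra scale_Lambda_P (intervals :: 'p set set) e_idem card
    (Lambda_P_plus :: ('k::field, 'p) Lambda_P set) Lambda_P_minus"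
proof -
  interpret elementary_algebra "scale_Lambda_P :: 'k \<Rightarrow> ('k, 'p) Lambda_P \<Rightarrow> _"
    by (rule elementary_algebra_Lambda_P)
  note plus = unital_subalgebra_Lambda_P_plus and minus = unital_subalgebra_Lambda_P_minus
  have sub: "Lambda_P.subspace Lambda_P_plus" "Lambda_P.subspace Lambda_P_minus"
    using plus minus by (auto simp: Lambda_P.unital_subalgebra_def)
  have finite: "finite S" for S :: "'p set" by simp
  show ?thesis
  proof
    show "Lambda_P.span (e_idem ` intervals) \<subseteq> Lambda_P_plus"
      by (rule Lambda_P.span_minimal[OF _ sub(1)]) (auto intro: e_idem_in_Lambda_P_plus)
    show "Lambda_P.span (e_idem ` intervals) \<subseteq> Lambda_P_minus"
      by (rule Lambda_P.span_minimal[OF _ sub(2)]) (auto intro: e_idem_in_Lambda_P_minus)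
    fix S :: "'p set" assume S: "S \<in> intervals"
    show "{e_idem S * x * e_idem S | x. x \<in> (Lambda_P_plus :: ('k, 'p) Lambda_P set)} =
        {scale_Lambda_P c (e_idem S) | c. True}"
      by (rule sandwich_set_eq[OF S sub(1) e_idem_in_Lambda_P_plus[OF S]])
    show "{e_idem S * x * e_idem S | x. x \<in> (Lambda_P_minus :: ('k, 'p) Lambda_P set)} =
        {scale_Lambda_P c (e_idem S) | c. True}"
      by (rule sandwich_set_eq[OF S sub(2) e_idem_in_Lambda_P_minus[OF S]])
    fix T :: "'p set" assume T: "T \<in> intervals" "S \<noteq> T"
    show "card S < card T"
      if nz: "{e_idem T * x * e_idem S | x. x \<in> (Lambda_P_plus :: ('k, 'p) Lambda_P set)} \<noteq> {0}"
    proof -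
      obtain a :: "('k, 'p) Lambda_P" and x where "a \<in> Lambda_P_plus" "entry a T S x \<noteq> 0"
        using sandwich_set_nonzero[OF T(1) S Lambda_P.subspace_0[OF sub(1)] nz] by blast
      \<comment> \<open>The left factor acts first, so \<open>e_idem T * x * e_idem S\<close>
        selects morphisms from the summand of \<open>T\<close> to that of \<open>S\<close>; the
        target is the smaller interval.\<close>
      then have "S \<in> downset_intervals T" by (auto simp: Lambda_P_plus_iff)
      then have "S \<subset> T"
        using T(2) relative_downset_subset by (auto simp: downset_intervals_def)
      then show ?thesis by (rule psubset_card_mono[OF finite])
    qed
    show "card T < card S"
      if nz: "{e_idem T * x * e_idem S | x. x \<in> (Lambda_P_minus :: ('k, 'p) Lambda_P set)} \<noteq> {0}"
    proof -
      obtain a :: "('k, 'p) Lambda_P" and x where "a \<in> Lambda_P_minus" "entry a T S x \<noteq> 0"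
        using sandwich_set_nonzero[OF T(1) S Lambda_P.subspace_0[OF sub(2)] nz] by blast
      then have "T \<in> upset_intervals S" by (auto simp: Lambda_P_minus_iff)
      then have "T \<subset> S"
        using T(2) relative_upset_subset by (auto simp: upset_intervals_def)
      then show ?thesis by (rule psubset_card_mono[OF finite])
    qed
  qed (fact plus minus complete_primitive_orthogonal_idempotents_e_idem mult_induces_iso_Lambda_P)+
qed

end
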